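(* Let $\sigma$ be an ascent sequence of length at least $2$. If $\sigma\in\{11,12,121\}$, then $\mathrm{Sort}^{\mathcal{A}}(\sigma)$ is a class. In all the other cases, $\mathrm{Sort}^{\mathcal{A}}(\sigma)$ is a class if and only if $\sigma$ contains $123$. Moreover, if $\sigma$ contains $123$, then $\mathrm{Sort}^{\mathcal{A}}(\sigma)=\mathcal{A}(132)$.
   Context: For a word $x_1\cdots x_i$ of positive integers, $\mathrm{asc}(x_1\cdots x_i)$ is the number of indices $j<i$ with $x_j<x_{j+1}$. An ascent sequence is a word $x_1\cdots x_n$ of positive integers with $x_1=1$ and $x_{i+1}\le 2+\mathrm{asc}(x_1\cdots x_i)$ for each $i\le n-1$; $\mathcal{A}$ is the set of ascent sequences. A word $x$ contains a pattern $y=y_1\cdots y_k$ if it has a subsequence $x_{i_1}\cdots x_{i_k}$ ($i_1<\dots<i_k$) such that for all $s,t$: $x_{i_s}<x_{i_t}$ iff $y_s<y_t$, and $x_{i_s}=x_{i_t}$ iff $y_s=y_t$; otherwise $x$ avoids $y$. $\mathcal{A}(132)$ is the set of ascent sequences avoiding $132$. A class is here a subset of $\mathcal{A}$ closed downwards under containment in $\mathcal{A}$ (if $x$ is in the set, $y\in\mathcal{A}$ and $x$ contains $y$, then $y$ is in the set). For a word $\sigma$ of length at least $2$, the $\sigma$-stack acts on an input word $\pi=\pi_1\cdots\pi_n$ of positive integers as follows (starting with empty stack and output). For $i=1,\dots,n$: as long as pushing $\pi_i$ on top of the stack would make the content of the stack, read from top to bottom, contain an occurrence of $\sigma$, pop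 the top element and append it to the output; then push $\pi_i$. After all letters have been pushed, pop all remaining elements, from top to bottom, appending them to the output. The resulting output is denoted $\mathcal{S}^{\sigma}(\pi)$. A word $\pi$ is $\sigma$-sortable if $\mathcal{S}^{21}(\mathcal{S}^{\sigma}(\pi))$ is weakly increasing. $\mathrm{Sort}^{\mathcal{A}}(\sigma)$ is the set of $\sigma$-sortable ascent sequences. *)

theory Defs
  imports Main
begin

definition asc :: "nat list \<Rightarrow> nat" where
  "asc x = card {j. Suc j < length x \<and> x ! j < x ! Suc j}"

text \<open>Since lists are indexed from \<open>0\<close>, the letter \<open>x ! i\<close> and the prefix \<open>take i x\<close> are
  $x_{i+1}$ and $x_1\cdots x_i$. Ascent sequences are nonempty, as they have a first letter.\<close>

definition ascent_sequences :: "nat list set" where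
  "ascent_sequences =
    {x. x \<noteq> [] \<and> (\<forall>a\<in>set x. 1 \<le> a) \<and> x ! 0 = 1 \<and>
        (\<forall>i. 1 \<le> i \<and> i < length x \<longrightarrow> x ! i \<le> 2 + asc (take i x))}"

definition contains :: "nat list \<Rightarrow> nat list \<Rightarrow> bool" where
  "contains x y \<longleftrightarrow>
    (\<exists>f. strict_mono_on {..<length y} f \<and> f ` {..<length y} \<subseteq> {..<length x} \<and>
         (\<forall>s<length y. \<forall>t<length y.
            (x ! f s < x ! f t \<longleftrightarrow> y ! s < y ! t) \<and> (x ! f s = x ! f t \<longleftrightarrow> y ! s = y ! t)))"

definition avoiding_ascent_sequences :: "nat list \<Rightarrow> nat list set" where
  "avoiding_ascent_sequences p = {x \<in> ascent_sequences. \<not> contains x p}"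

definition is_class :: "nat list set \<Rightarrow> bool" where
  "is_class C \<longleftrightarrow>
    C \<subseteq> ascent_sequences \<and> (\<forall>x\<in>C. \<forall>y\<in>ascent_sequences. contains x y \<longrightarrow> y \<in> C)"

text \<open>Stacks are lists whose head is the top. \<open>pop_for \<sigma> a s\<close> is the pair of the letters popped
  from \<open>s\<close> (in order of output) and the remaining stack, onto which \<open>a\<close> can be pushed. The
  equation for the empty stack is never a real choice when \<open>\<sigma>\<close> has length at least \<open>2\<close>, because
  a one-letter stack cannot contain \<open>\<sigma>\<close>.\<close>

fun pop_for :: "nat list \<Rightarrow> nat \<Rightarrow> nat list \<Rightarrow> nat list \<times> nat list" where
  "pop_for \<sigma> a [] = ([], [])"
| "pop_for \<sigma> a (t # s) =
    (if contains (a # t # s) \<sigma>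
     then (let (popped, rest) = pop_for \<sigma> a s in (t # popped, rest))
     else ([], t # s))"

text \<open>\<open>stack_run \<sigma> s \<pi>\<close> is the further output produced from stack content \<open>s\<close> and remaining
  input \<open>\<pi>\<close>.\<close>

fun stack_run :: "nat list \<Rightarrow> nat list \<Rightarrow> nat list \<Rightarrow> nat list" where
  "stack_run \<sigma> s [] = s"
| "stack_run \<sigma> s (a # \<pi>) =
    (let (popped, rest) = pop_for \<sigma> a s in popped @ stack_run \<sigma> (a # rest) \<pi>)"

definition stack_output :: "nat list \<Rightarrow> nat list \<Rightarrow> nat list" where
  "stack_output \<sigma> \<pi> = stack_run \<sigma> [] \<pi>"

definition stack_sortable :: "nat list \<Rightarrow> nat list \<Rightarrow> bool" where
  "stack_sortable \<sigma> \<pi> \<longleftrightarrow> sorted (stack_output [2, 1] (stack_output \<sigma> \<pi>))"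

definition sortable_ascent_sequences :: "nat list \<Rightarrow> nat list set" where
  "sortable_ascent_sequences \<sigma> = {\<pi> \<in> ascent_sequences. stack_sortable \<sigma> \<pi>}"

end

theory Submission
  imports Defs "HOL-Library.Sublist"
begin

text \<open>
  An ascent sequence starts with its least letter \<open>1\<close>, and its first letter other than \<open>1\<close> is
  \<open>2\<close>. The letter \<open>1\<close> at the bottom of the \<open>\<sigma>\<close>-stack stays there, up to being exchanged for
  another \<open>1\<close>, so the output of the \<open>\<sigma>\<close>-stack ends with \<open>1\<close>. Since a \<open>21\<close>-stack sorts exactly the
  words without the pattern \<open>231\<close>, an ascent sequence is \<open>\<sigma>\<close>-sortable iff its output has no letters
  \<open>y\<close>, \<open>z\<close> with \<open>2 \<le> y < z\<close> and \<open>y\<close> before \<open>z\<close> (\<open>stack_sortable_iff\<close>). Such a pair is called an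
  inversion of the output below.

  If \<open>\<sigma>\<close> contains \<open>123\<close>, the first letter that cannot be pushed without a pop finds a stack in which
  some \<open>y \<ge> 2\<close> lies above some \<open>z > y\<close>; these two leave the stack in this order, so the word is not
  sortable. A word without such a conflict is reversed by the stack, and its reversal has no inversion
  iff the word avoids \<open>132\<close> (\<open>sortable_iff_avoids_132\<close>).

  For \<open>\<sigma>\<close> in \<open>{11, 12, 121}\<close>, sortability is avoidance of \<open>{1213, 1223}\<close>, \<open>{213}\<close> and
  \<open>{1213}\<close> respectively, and every set described by avoidance is a class. The case \<open>12\<close> is direct. For
  \<open>11\<close> and \<open>121\<close> the key is \<open>smaller_letters_occur_before\<close>: in an ascent sequence avoiding \<open>1213\<close>,
  a letter \<open>b\<close> is preceded by all of the values \<open>1, \<dots>, b - 1\<close>. If an inversion \<open>y\<close>, \<open>z\<close> of the output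
  arises although the patterns are avoided, then at some moment a larger letter \<open>b\<close> lies below \<open>y\<close> in the stack;
  an earlier copy of \<open>y\<close> precedes \<open>b\<close> in the input, and as \<open>y b y\<close> is not allowed in the
  stack, this copy was popped before \<open>b\<close> entered. This is the same situation at an earlier
  time, hence infinite descent applies.

  In the remaining case \<open>\<sigma>\<close> avoids \<open>123\<close>, so it is a word over \<open>{1, 2}\<close>. The word \<open>1232\<close> passes the
  stack without pops and is not sortable. On the other hand a sortable word containing \<open>1232\<close>
  is built from \<open>\<sigma>\<close>: fill the stack with a word such that \<open>3\<close> can still be pushed, but then a \<open>1\<close> forces
  the \<open>3\<close> out before the final \<open>2\<close> arrives (\<open>not_class_if_stack_content\<close>). For \<open>\<sigma> = 1 c \<tau>\<close> with a letter
  \<open>2\<close> the content \<open>c \<tau> 1\<close> works, for \<open>\<sigma> = 1 \<dots> 1\<close> of length \<open>n\<close> the content \<open>2 1 \<dots> 1\<close>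
  with \<open>n - 1\<close> ones.
\<close>

section \<open>Patterns as subsequences\<close>

definition order_iso :: "nat list \<Rightarrow> nat list \<Rightarrow> bool" where
  "order_iso z y \<longleftrightarrow> length z = length y \<and>
    (\<forall>s<length y. \<forall>t<length y. (z ! s < z ! t \<longleftrightarrow> y ! s < y ! t) \<and> (z ! s = z ! t \<longleftrightarrow> y ! s = y ! t))"

lemma order_iso_Nil [simp]: "order_iso z [] \<longleftrightarrow> z = []"
  by (auto simp: order_iso_def)

lemma order_iso_Nil_left [simp]: "order_iso [] y \<longleftrightarrow> y = []"
  by (auto simp: order_iso_def)

lemma order_iso_Cons [simp]:
  "order_iso (a # z) (b # y) \<longleftrightarrow>
    list_all2 (\<lambda>c d. (a < c \<longleftrightarrow> b < d) \<and> (a = c \<longleftrightarrow> b = d)) z y \<and> order_iso z y"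
  (is "?L \<longleftrightarrow> ?R")
proof
  assume L: ?L
  then have len: "length z = length y" by (simp add: order_iso_def)
  have L': "((a # z) ! s < (a # z) ! t \<longleftrightarrow> (b # y) ! s < (b # y) ! t) \<and>
      ((a # z) ! s = (a # z) ! t \<longleftrightarrow> (b # y) ! s = (b # y) ! t)"
    if "s < Suc (length y)" "t < Suc (length y)" for s t
    using L that by (simp add: order_iso_def)
  have "(a < z ! i \<longleftrightarrow> b < y ! i) \<and> (a = z ! i \<longleftrightarrow> b = y ! i)" if "i < length y" for i
    using L'[of 0 "Suc i"] that unfolding nth_Cons_Suc nth_Cons_0 by blast
  moreover have "(z ! s < z ! t \<longleftrightarrow> y ! s < y ! t) \<and> (z ! s = z ! t \<longleftrightarrow> y ! s = y ! t)"
    if "s < length y" "t < length y" for s t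
    using L'[of "Suc s" "Suc t"] that unfolding nth_Cons_Suc by blast
  ultimately show ?R
    using len unfolding order_iso_def list_all2_conv_all_nth by presburger
next
  assume R: ?R
  then have "length z = length y"
    and "\<And>i. i < length y \<Longrightarrow> (a < z ! i \<longleftrightarrow> b < y ! i) \<and> (a = z ! i \<longleftrightarrow> b = y ! i)"
    by (auto simp: list_all2_conv_all_nth)
  moreover from this(2) have "\<And>i. i < length y \<Longrightarrow> (z ! i < a \<longleftrightarrow> y ! i < b) \<and> (z ! i = a \<longleftrightarrow> y ! i = b)"
    by (metis antisym_conv3 less_asym')
  moreover from R have "\<forall>s<length y. \<forall>t<length y.
      (z ! s < z ! t \<longleftrightarrow> y ! s < y ! t) \<and> (z ! s = z ! t \<longleftrightarrow> y ! s = y ! t)"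
    by (simp add: order_iso_def)
  ultimately show ?L
    by (simp add: order_iso_def All_less_Suc2)
qed

lemma order_iso_Cons_right:
  "order_iso z (b # y) \<longleftrightarrow> (\<exists>a z'. z = a # z' \<and>
    list_all2 (\<lambda>c d. (a < c \<longleftrightarrow> b < d) \<and> (a = c \<longleftrightarrow> b = d)) z' y \<and> order_iso z' y)"
  by (cases z) auto

lemma subseq_if_indices_increase:
  assumes "strict_mono_on {..<n} f" and "f ` {..<n} \<subseteq> {..<length x}"
  shows "subseq (map (\<lambda>s. x ! f s) [0..<n]) x"
  using assms
proof (induction n arbitrary: x)
  case 0
  then show ?case by simp
next
  case (Suc n)
  have fn: "f n < length x" using Suc.prems by auto
  have less: "f s < f n" if "s < n" for s
    using Suc.prems(1) that by (auto simp: strict_mono_on_def)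
  have "subseq (map (\<lambda>s. take (f n) x ! f s) [0..<n]) (take (f n) x)"
    by (rule Suc.IH) (use Suc.prems less fn in \<open>auto simp: strict_mono_on_def\<close>)
  also have "map (\<lambda>s. take (f n) x ! f s) [0..<n] = map (\<lambda>s. x ! f s) [0..<n]"
    using less by simp
  finally have "subseq (map (\<lambda>s. x ! f s) [0..<n] @ [x ! f n]) (take (f n) x @ x ! f n # drop (Suc (f n)) x)"
    by (intro list_emb_append_mono) simp_all
  then show ?case using fn by (simp add: id_take_nth_drop[symmetric])
qed

lemma indices_of_subseq:
  assumes "subseq z x"
  shows "\<exists>f. strict_mono_on {..<length z} f \<and> f ` {..<length z} \<subseteq> {..<length x} \<and>
    (\<forall>s<length z. x ! f s = z ! s)"
  using assms
proof (induction z arbitrary: x)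
  case Nil
  then show ?case by (auto simp: strict_mono_on_def)
next
  case (Cons a z)
  then obtain us vs where x: "x = us @ a # vs" and "subseq z vs"
    by (blast dest: list_emb_ConsD)
  with Cons.IH obtain f where f: "strict_mono_on {..<length z} f"
      "f ` {..<length z} \<subseteq> {..<length vs}" "\<forall>s<length z. vs ! f s = z ! s" by blast
  \<comment> \<open>The first letter goes to the end of \<open>us\<close>, the others are shifted past it.\<close>
  let ?g = "\<lambda>s. case s of 0 \<Rightarrow> length us | Suc s' \<Rightarrow> Suc (length us + f s')"
  have "strict_mono_on {..<length (a # z)} ?g"
    using f(1) by (auto simp: strict_mono_on_def split: nat.splits)
  moreover have "?g ` {..<length (a # z)} \<subseteq> {..<length x}"
    using f(2) x by (auto split: nat.splits simp: image_subset_iff)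
  moreover have "\<forall>s<length (a # z). x ! ?g s = (a # z) ! s"
    using f(3) x by (auto simp: nth_append nth_Cons split: nat.splits)
  ultimately show ?case by blast
qed

text \<open>
  Containment is mostly used in this form, because subsequences combine along \<open>@\<close>
  and \<open>#\<close> without any arithmetic on positions.
\<close>

lemma contains_iff: "contains x y \<longleftrightarrow> (\<exists>z. subseq z x \<and> order_iso z y)"
proof
  assume "contains x y"
  then obtain f where f: "strict_mono_on {..<length y} f" "f ` {..<length y} \<subseteq> {..<length x}"
    "\<forall>s<length y. \<forall>t<length y. (x ! f s < x ! f t \<longleftrightarrow> y ! s < y ! t) \<and> (x ! f s = x ! f t \<longleftrightarrow> y ! s = y ! t)"
    unfolding contains_def by blast
  then have "order_iso (map (\<lambda>s. x ! f s) [0..<length y]) y"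
    by (simp add: order_iso_def)
  with subseq_if_indices_increase[OF f(1,2)] show "\<exists>z. subseq z x \<and> order_iso z y" by blast
next
  assume "\<exists>z. subseq z x \<and> order_iso z y"
  then obtain z where z: "subseq z x" "order_iso z y" by blast
  from indices_of_subseq[OF z(1)] obtain f where f: "strict_mono_on {..<length z} f"
    "f ` {..<length z} \<subseteq> {..<length x}" "\<forall>s<length z. x ! f s = z ! s" by blast
  with z(2) show "contains x y" unfolding contains_def order_iso_def
    by (intro exI[of _ f]) simp
qed

lemma contains_self: "contains x x"
  unfolding contains_iff order_iso_def by blast

lemma contains_mono: "contains x p \<Longrightarrow> subseq x x' \<Longrightarrow> contains x' p"
  unfolding contains_iff by (blast intro: subseq_order.trans)

lemma contains_trans:
  assumes "contains x y" and "contains y z"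
  shows "contains x z"
proof -
  from assms(1) obtain f where f: "strict_mono_on {..<length y} f" "f ` {..<length y} \<subseteq> {..<length x}"
    "\<forall>s<length y. \<forall>t<length y. (x ! f s < x ! f t \<longleftrightarrow> y ! s < y ! t) \<and> (x ! f s = x ! f t \<longleftrightarrow> y ! s = y ! t)"
    unfolding contains_def by blast
  from assms(2) obtain g where g: "strict_mono_on {..<length z} g" "g ` {..<length z} \<subseteq> {..<length y}"
    "\<forall>s<length z. \<forall>t<length z. (y ! g s < y ! g t \<longleftrightarrow> z ! s < z ! t) \<and> (y ! g s = y ! g t \<longleftrightarrow> z ! s = z ! t)"
    unfolding contains_def by blast
  have gl: "g s < length y" if "s < length z" for s using g(2) that by auto
  have "strict_mono_on {..<length z} (f \<circ> g)"
    using f(1) g(1) gl by (auto simp: strict_mono_on_def)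
  moreover have "(f \<circ> g) ` {..<length z} \<subseteq> {..<length x}" using f(2) g(2) by fastforce
  ultimately show ?thesis
    unfolding contains_def using f(3) g(3) gl by (intro exI[of _ "f \<circ> g"]) simp
qed

lemma length_le_if_contains: "contains x p \<Longrightarrow> length p \<le> length x"
  unfolding contains_iff order_iso_def by (metis list_emb_length)

lemma contains_11: "contains x [1, 1] \<longleftrightarrow> (\<exists>a. subseq [a, a] x)"
  by (auto simp: contains_iff order_iso_Cons_right)

lemma contains_12: "contains x [1, 2] \<longleftrightarrow> (\<exists>a b. subseq [a, b] x \<and> a < b)"
proof -
  have iso: "order_iso z [1, 2] \<longleftrightarrow> (\<exists>a b. z = [a, b] \<and> a < b)" for z
    by (auto simp: order_iso_Cons_right)
  show ?thesis unfolding contains_iff iso by blast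
qed

lemma contains_123: "contains x [1, 2, 3] \<longleftrightarrow> (\<exists>a b c. subseq [a, b, c] x \<and> a < b \<and> b < c)"
proof -
  have iso: "order_iso z [1, 2, 3] \<longleftrightarrow> (\<exists>a b c. z = [a, b, c] \<and> a < b \<and> b < c)" for z
    by (auto simp: order_iso_Cons_right)
  show ?thesis unfolding contains_iff iso by blast
qed

lemma contains_132: "contains x [1, 3, 2] \<longleftrightarrow> (\<exists>a b c. subseq [a, b, c] x \<and> a < c \<and> c < b)"
proof -
  have iso: "order_iso z [1, 3, 2] \<longleftrightarrow> (\<exists>a b c. z = [a, b, c] \<and> a < c \<and> c < b)" for z
    by (auto simp: order_iso_Cons_right)
  show ?thesis unfolding contains_iff iso by blast
qed

lemma contains_213: "contains x [2, 1, 3] \<longleftrightarrow> (\<exists>a b c. subseq [a, b, c] x \<and> b < a \<and> a < c)"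
proof -
  have iso: "order_iso z [2, 1, 3] \<longleftrightarrow> (\<exists>a b c. z = [a, b, c] \<and> b < a \<and> a < c)" for z
    by (auto simp: order_iso_Cons_right)
  show ?thesis unfolding contains_iff iso by blast
qed

lemma contains_121: "contains x [1, 2, 1] \<longleftrightarrow> (\<exists>a b. subseq [a, b, a] x \<and> a < b)"
proof -
  have iso: "order_iso z [1, 2, 1] \<longleftrightarrow> (\<exists>a b. z = [a, b, a] \<and> a < b)" for z
    by (auto simp: order_iso_Cons_right)
  show ?thesis unfolding contains_iff iso by blast
qed

lemma contains_1213: "contains x [1, 2, 1, 3] \<longleftrightarrow> (\<exists>a b c. subseq [a, b, a, c] x \<and> a < b \<and> b < c)"
proof -
  have iso: "order_iso z [1, 2, 1, 3] \<longleftrightarrow> (\<exists>a b c. z = [a, b, a, c] \<and> a < b \<and> b < c)" for z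
    by (auto simp: order_iso_Cons_right)
  show ?thesis unfolding contains_iff iso by blast
qed

lemma contains_1223: "contains x [1, 2, 2, 3] \<longleftrightarrow> (\<exists>a b c. subseq [a, b, b, c] x \<and> a < b \<and> b < c)"
proof -
  have iso: "order_iso z [1, 2, 2, 3] \<longleftrightarrow> (\<exists>a b c. z = [a, b, b, c] \<and> a < b \<and> b < c)" for z
    by (auto simp: order_iso_Cons_right)
  show ?thesis unfolding contains_iff iso by blast
qed

section \<open>Runs of a stack\<close>

lemma hd_ascent: "x \<in> ascent_sequences \<Longrightarrow> \<exists>x'. x = 1 # x'"
  by (cases x) (auto simp: ascent_sequences_def)

lemma ascent_pos: "x \<in> ascent_sequences \<Longrightarrow> a \<in> set x \<Longrightarrow> 1 \<le> a"
  by (auto simp: ascent_sequences_def)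

lemma subseq_Cons_iff: "subseq (b # u) (k # w) \<longleftrightarrow> b = k \<and> subseq u w \<or> subseq (b # u) w"
  by (auto dest: subseq_Cons')

lemma set_subset_if_subseq: "subseq u w \<Longrightarrow> set u \<subseteq> set w"
  by (metis set_nths_subset subseq_conv_nths)

lemma subseq_pair_append_iff:
  "subseq [y, z] (u @ v) \<longleftrightarrow> subseq [y, z] u \<or> y \<in> set u \<and> z \<in> set v \<or> subseq [y, z] v"
proof
  assume "subseq [y, z] (u @ v)"
  then show "subseq [y, z] u \<or> y \<in> set u \<and> z \<in> set v \<or> subseq [y, z] v"
    by (cases rule: subseq_appendE)
      (auto simp: Cons_eq_append_conv subseq_singleton_left dest: subseq_Cons')
next
  assume "subseq [y, z] u \<or> y \<in> set u \<and> z \<in> set v \<or> subseq [y, z] v"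
  then show "subseq [y, z] (u @ v)"
    using list_emb_append_mono[of "(=)" "[y]" u "[z]" v]
    by (auto simp: subseq_singleton_left subseq_rev_drop_many)
qed

lemma subseq_pair_Cons_iff:
  "subseq [y, z] (a # v) \<longleftrightarrow> y = a \<and> z \<in> set v \<or> subseq [y, z] v"
  using subseq_pair_append_iff[of y z "[a]" v] by auto

lemma subseq_rev_iff: "subseq (rev u) (rev v) \<longleftrightarrow> subseq u v"
proof -
  have "subseq (rev u) (rev v)" if "subseq u v" for u v :: "'a list"
    using that by (induction) (auto intro: list_emb_append_mono subseq_rev_drop_many)
  from this[of u v] this[of "rev u" "rev v"] show ?thesis by auto
qed

lemma pop_for_append: "fst (pop_for \<sigma> a s) @ snd (pop_for \<sigma> a s) = s"
  by (induction s) (auto simp: Let_def split: prod.splits)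

lemma pop_for_none: "\<not> contains (a # s) \<sigma> \<Longrightarrow> pop_for \<sigma> a s = ([], s)"
  by (cases s) auto

lemma pop_for_rest: "snd (pop_for \<sigma> a s) = [] \<or> \<not> contains (a # snd (pop_for \<sigma> a s)) \<sigma>"
  by (induction s) (auto simp: Let_def split: prod.splits)

lemma pop_for_popped:
  "y \<in> set (fst (pop_for \<sigma> a s)) \<Longrightarrow> \<exists>u v. s = u @ y # v \<and> contains (a # y # v) \<sigma>"
proof (induction s)
  case (Cons t s)
  show ?case
  proof (cases "contains (a # t # s) \<sigma>")
    case True
    with Cons.prems have "y = t \<or> y \<in> set (fst (pop_for \<sigma> a s))"
      by (auto simp: Let_def split: prod.splits)
    then show ?thesis
    proof
      assume "y = t"
      with True show ?thesis by (intro exI[of _ "[]"] exI[of _ s]) simp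
    next
      assume "y \<in> set (fst (pop_for \<sigma> a s))"
      with Cons.IH obtain u v where "s = u @ y # v" "contains (a # y # v) \<sigma>" by blast
      then show ?thesis by (intro exI[of _ "t # u"] exI[of _ v]) simp
    qed
  next
    case False
    with Cons.prems show ?thesis by simp
  qed
qed simp

text \<open>
  The stack is emptied only if the bottom letter is in the way when it is alone.
\<close>

lemma pop_for_everything:
  "snd (pop_for \<sigma> a s) = [] \<Longrightarrow> s \<noteq> [] \<Longrightarrow> contains [a, last s] \<sigma>"
  by (induction s) (auto simp: Let_def split: prod.splits if_splits)

text \<open>
  A run is cut at an arbitrary point of the input into the output produced so far and the stack
  reached, so that the moment at which a letter enters or leaves the stack becomes a prefix of
  the input.
\<close>

fun stack_after :: "nat list \<Rightarrow> nat list \<Rightarrow> nat list \<Rightarrow> nat list" where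
  "stack_after \<sigma> s [] = s"
| "stack_after \<sigma> s (a # \<pi>) = stack_after \<sigma> (a # snd (pop_for \<sigma> a s)) \<pi>"

fun output_after :: "nat list \<Rightarrow> nat list \<Rightarrow> nat list \<Rightarrow> nat list" where
  "output_after \<sigma> s [] = []"
| "output_after \<sigma> s (a # \<pi>) =
    fst (pop_for \<sigma> a s) @ output_after \<sigma> (a # snd (pop_for \<sigma> a s)) \<pi>"

lemma stack_run_Cons:
  "stack_run \<sigma> s (a # \<pi>) = fst (pop_for \<sigma> a s) @ stack_run \<sigma> (a # snd (pop_for \<sigma> a s)) \<pi>"
  by (simp add: Let_def split: prod.splits)

declare stack_run.simps(2) [simp del]

lemma stack_run_append:
  "stack_run \<sigma> s (\<pi> @ \<rho>) = output_after \<sigma> s \<pi> @ stack_run \<sigma> (stack_after \<sigma> s \<pi>) \<rho>"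
  by (induction \<pi> arbitrary: s) (simp_all add: stack_run_Cons)

lemma stack_after_append:
  "stack_after \<sigma> s (\<pi> @ \<rho>) = stack_after \<sigma> (stack_after \<sigma> s \<pi>) \<rho>"
  by (induction \<pi> arbitrary: s) simp_all

lemma output_after_append:
  "output_after \<sigma> s (\<pi> @ \<rho>) = output_after \<sigma> s \<pi> @ output_after \<sigma> (stack_after \<sigma> s \<pi>) \<rho>"
  by (induction \<pi> arbitrary: s) simp_all

lemma stack_after_snoc:
  "stack_after \<sigma> s (\<pi> @ [a]) = a # snd (pop_for \<sigma> a (stack_after \<sigma> s \<pi>))"
  by (simp add: stack_after_append)

lemma set_output_stack:
  "set (output_after \<sigma> s \<pi>) \<union> set (stack_after \<sigma> s \<pi>) = set s \<union> set \<pi>"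
proof (induction \<pi> arbitrary: s)
  case (Cons a \<pi>)
  have "set s = set (fst (pop_for \<sigma> a s)) \<union> set (snd (pop_for \<sigma> a s))"
    by (metis pop_for_append set_append)
  with Cons.IH[of "a # snd (pop_for \<sigma> a s)"] show ?case by auto
qed simp

lemma set_stack_run: "set (stack_run \<sigma> s \<pi>) = set s \<union> set \<pi>"
proof (induction \<pi> arbitrary: s)
  case (Cons a \<pi>)
  have "set s = set (fst (pop_for \<sigma> a s)) \<union> set (snd (pop_for \<sigma> a s))"
    by (metis pop_for_append set_append)
  with Cons.IH[of "a # snd (pop_for \<sigma> a s)"] show ?case by (auto simp: stack_run_Cons)
qed simp

lemma stack_before_output: "subseq s (stack_run \<sigma> s \<pi>)"
proof (induction \<pi> arbitrary: s)
  case (Cons a \<pi>)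
  have "subseq (fst (pop_for \<sigma> a s) @ snd (pop_for \<sigma> a s)) (stack_run \<sigma> s (a # \<pi>))"
    unfolding stack_run_Cons using Cons.IH[of "a # snd (pop_for \<sigma> a s)"]
    by (intro list_emb_append_mono) (auto dest: subseq_Cons')
  then show ?case by (simp only: pop_for_append)
qed simp

lemma stack_avoids:
  assumes "\<not> contains s \<sigma>" and "2 \<le> length \<sigma>"
  shows "\<not> contains (stack_after \<sigma> s \<pi>) \<sigma>"
  using assms(1)
proof (induction \<pi> arbitrary: s)
  case (Cons a \<pi>)
  \<comment> \<open>The equation for the empty stack pushes without a test; a one-letter stack avoids \<open>\<sigma>\<close> by its length.\<close>
  have "\<not> contains [a] \<sigma>" using assms(2) length_le_if_contains by fastforce
  with pop_for_rest[of \<sigma> a s] have "\<not> contains (a # snd (pop_for \<sigma> a s)) \<sigma>" by auto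
  with Cons.IH show ?case by simp
qed simp

lemma empty_stack_avoids: "2 \<le> length \<sigma> \<Longrightarrow> \<not> contains [] \<sigma>"
  using length_le_if_contains by fastforce

lemma subseq_rev_stack: "subseq (rev (stack_after \<sigma> s \<pi>)) (rev s @ \<pi>)"
proof (induction \<pi> arbitrary: s)
  case (Cons a \<pi>)
  have "subseq (snd (pop_for \<sigma> a s)) s"
    by (metis list_emb_append2 pop_for_append subseq_order.order_refl)
  then have "subseq (rev (snd (pop_for \<sigma> a s)) @ (a # \<pi>)) (rev s @ (a # \<pi>))"
    by (intro list_emb_append_mono) (simp_all add: subseq_rev_iff)
  then show ?case
    using subseq_order.trans[OF Cons.IH[of "a # snd (pop_for \<sigma> a s)"]] by auto
qed simp

text \<open>
  What lies below an occurrence of a letter does not change while this occurrence is on the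
  stack. The moment \<open>\<alpha>\<close> at which it was pushed therefore already shows the
  content below it.
\<close>

lemma pushed_moment:
  assumes "stack_after \<sigma> [] \<pi> = u @ b # w"
  shows "\<exists>\<alpha> \<beta>. \<pi> = \<alpha> @ b # \<beta> \<and> stack_after \<sigma> [] (\<alpha> @ [b]) = b # w"
  using assms
proof (induction \<pi> arbitrary: u rule: rev_induct)
  case (snoc k \<pi>)
  show ?case
  proof (cases u)
    case Nil
    with snoc.prems show ?thesis
      by (intro exI[of _ \<pi>] exI[of _ "[]"]) (auto simp: stack_after_snoc)
  next
    case (Cons k' u')
    with snoc.prems have "snd (pop_for \<sigma> k (stack_after \<sigma> [] \<pi>)) = u' @ b # w"
      by (auto simp: stack_after_snoc)
    then have "stack_after \<sigma> [] \<pi> = (fst (pop_for \<sigma> k (stack_after \<sigma> [] \<pi>)) @ u') @ b # w"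
      using pop_for_append[of \<sigma> k "stack_after \<sigma> [] \<pi>"] by simp
    from snoc.IH[OF this] obtain \<alpha> \<beta> where "\<pi> = \<alpha> @ b # \<beta>"
      "stack_after \<sigma> [] (\<alpha> @ [b]) = b # w" by blast
    then show ?thesis by (intro exI[of _ \<alpha>] exI[of _ "\<beta> @ [k]"]) simp
  qed
qed simp

lemma popped_moment:
  assumes "y \<in> set (output_after \<sigma> [] \<pi>)"
  shows "\<exists>\<alpha> k \<beta>. \<pi> = \<alpha> @ k # \<beta> \<and> y \<in> set (fst (pop_for \<sigma> k (stack_after \<sigma> [] \<alpha>)))"
  using assms
proof (induction \<pi> rule: rev_induct)
  case (snoc k \<pi>)
  then consider "y \<in> set (output_after \<sigma> [] \<pi>)" | "y \<in> set (fst (pop_for \<sigma> k (stack_after \<sigma> [] \<pi>)))"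
    by (auto simp: output_after_append)
  then show ?case
  proof cases
    case 1
    with snoc.IH obtain \<alpha> k' \<beta> where "\<pi> = \<alpha> @ k' # \<beta>"
      "y \<in> set (fst (pop_for \<sigma> k' (stack_after \<sigma> [] \<alpha>)))" by blast
    then show ?thesis by (intro exI[of _ \<alpha>] exI[of _ k'] exI[of _ "\<beta> @ [k]"]) simp
  next
    case 2
    then show ?thesis by blast
  qed
qed simp

lemma split_at_letter:
  assumes "p @ q = w @ y # r"
  shows "y \<in> set p \<or> (\<exists>w'. q = w' @ y # r)"
proof -
  from assms consider us where "q = us @ y # r" | us where "p = w @ us" "us @ q = y # r"
    by (auto simp: append_eq_append_conv2)
  then show ?thesis
  proof cases
    case 2
    then show ?thesis by (cases us) auto
  qed blast
qed

lemma retained_or_output: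
  "y \<in> set (output_after \<sigma> (w @ y # r) \<pi>) \<or> (\<exists>w'. stack_after \<sigma> (w @ y # r) \<pi> = w' @ y # r)"
proof (induction \<pi> arbitrary: w)
  case (Cons a \<pi>)
  let ?p = "fst (pop_for \<sigma> a (w @ y # r))" and ?q = "snd (pop_for \<sigma> a (w @ y # r))"
  have "?p @ ?q = w @ y # r" by (rule pop_for_append)
  then have "y \<in> set ?p \<or> (\<exists>w'. ?q = w' @ y # r)"
    by (rule split_at_letter)
  then show ?case
  proof
    assume "\<exists>w'. ?q = w' @ y # r"
    then obtain w' where "?q = w' @ y # r" by blast
    with Cons.IH[of "a # w'"] show ?case by auto
  qed simp
qed auto

text \<open>
  The tail \<open>v @ [a]\<close> is nonempty on purpose: if this occurrence of \<open>y\<close>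
  survives, the \<open>a\<close> on top is a different one, even when \<open>a = y\<close>.
\<close>

lemma pushed_above_or_output:
  "y \<in> set (output_after \<sigma> (y # r) (v @ [a])) \<or>
    (\<exists>w. stack_after \<sigma> (y # r) (v @ [a]) = a # w @ y # r)"
proof -
  have "y \<in> set (output_after \<sigma> (y # r) v) \<or> (\<exists>w. stack_after \<sigma> (y # r) v = w @ y # r)"
    using retained_or_output[of y \<sigma> "[]" r v] by simp
  then show ?thesis
  proof
    assume "\<exists>w. stack_after \<sigma> (y # r) v = w @ y # r"
    then obtain w where w: "stack_after \<sigma> (y # r) v = w @ y # r" by blast
    let ?p = "fst (pop_for \<sigma> a (w @ y # r))" and ?q = "snd (pop_for \<sigma> a (w @ y # r))"
    have "?p @ ?q = w @ y # r" by (rule pop_for_append)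
    then have "y \<in> set ?p \<or> (\<exists>w'. ?q = w' @ y # r)"
      by (rule split_at_letter)
    with w show ?thesis by (auto simp: output_after_append stack_after_snoc)
  qed (simp add: output_after_append)
qed

text \<open>
  A letter \<open>y\<close> precedes \<open>z\<close> in the output for one of two reasons:
  either \<open>y\<close> is popped before \<open>z\<close> enters (which includes the case that
  pushing \<open>z\<close> itself pops \<open>y\<close>), or \<open>y\<close> is pushed while
  \<open>z\<close> lies below.
\<close>

lemma inversion_in_output:
  assumes "subseq [y, z] (stack_output \<sigma> \<pi>)"
  shows "(\<exists>\<alpha> k \<beta>. \<pi> = \<alpha> @ k # \<beta> \<and> y \<in> set (fst (pop_for \<sigma> k (stack_after \<sigma> [] \<alpha>))) \<and>
            z \<in> set (k # \<beta>)) \<or>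
    (\<exists>\<alpha> \<beta> s. \<pi> = \<alpha> @ \<beta> \<and> stack_after \<sigma> [] \<alpha> = y # s \<and> z \<in> set s)"
proof -
  have "subseq [y, z] s \<or>
    (\<exists>\<alpha> k \<beta>. \<pi> = \<alpha> @ k # \<beta> \<and> y \<in> set (fst (pop_for \<sigma> k (stack_after \<sigma> s \<alpha>))) \<and>
            z \<in> set (k # \<beta>)) \<or>
    (\<exists>\<alpha> \<beta> s'. \<pi> = \<alpha> @ \<beta> \<and> stack_after \<sigma> s \<alpha> = y # s' \<and> z \<in> set s')"
    if "subseq [y, z] (stack_run \<sigma> s \<pi>)" for s
    using that
  proof (induction \<pi> arbitrary: s)
    case (Cons a \<pi>)
    let ?p = "fst (pop_for \<sigma> a s)" and ?r = "snd (pop_for \<sigma> a s)"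
    have s: "?p @ ?r = s" by (rule pop_for_append)
    from Cons.prems consider "subseq [y, z] ?p" | "y \<in> set ?p" "z \<in> set (a # ?r) \<union> set \<pi>"
      | "subseq [y, z] (stack_run \<sigma> (a # ?r) \<pi>)"
      unfolding stack_run_Cons subseq_pair_append_iff set_stack_run by blast
    then show ?case
    proof cases
      case 1
      then have "subseq [y, z] s" using s subseq_pair_append_iff by metis
      then show ?thesis ..
    next
      case 2
      show ?thesis
      proof (cases "z \<in> set ?r")
        case True
        with 2 have "subseq [y, z] s" using s subseq_pair_append_iff by metis
        then show ?thesis ..
      next
        case False
        with 2 have "a # \<pi> = [] @ a # \<pi> \<and> y \<in> set (fst (pop_for \<sigma> a (stack_after \<sigma> s []))) \<and> z \<in> set (a # \<pi>)"
          by simp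
        then show ?thesis by blast
      qed
    next
      case 3
      from Cons.IH[OF this] consider "y = a" "z \<in> set ?r" | "subseq [y, z] ?r"
        | \<alpha> k \<beta> where "\<pi> = \<alpha> @ k # \<beta>" "y \<in> set (fst (pop_for \<sigma> k (stack_after \<sigma> (a # ?r) \<alpha>)))" "z \<in> set (k # \<beta>)"
        | \<alpha> \<beta> s' where "\<pi> = \<alpha> @ \<beta>" "stack_after \<sigma> (a # ?r) \<alpha> = y # s'" "z \<in> set s'"
        unfolding subseq_pair_Cons_iff by blast
      then show ?thesis
      proof cases
        case 1
        then have "a # \<pi> = [a] @ \<pi> \<and> stack_after \<sigma> s [a] = y # ?r \<and> z \<in> set ?r" by simp
        then show ?thesis by blast
      next
        case 2
        then have "subseq [y, z] s" using s subseq_pair_append_iff by metis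
        then show ?thesis ..
      next
        case 3
        then have "a # \<pi> = (a # \<alpha>) @ k # \<beta> \<and>
          y \<in> set (fst (pop_for \<sigma> k (stack_after \<sigma> s (a # \<alpha>)))) \<and> z \<in> set (k # \<beta>)" by simp
        then show ?thesis by blast
      next
        case 4
        then have "a # \<pi> = (a # \<alpha>) @ \<beta> \<and> stack_after \<sigma> s (a # \<alpha>) = y # s' \<and> z \<in> set s'" by simp
        then show ?thesis by blast
      qed
    qed
  qed simp
  from this[of "[]"] assms show ?thesis by (simp add: stack_output_def)
qed

section \<open>Sortability of ascent sequences\<close>

lemma contains_21: "contains x [2, 1] \<longleftrightarrow> (\<exists>a b. subseq [a, b] x \<and> b < a)"
proof -
  have iso: "order_iso z [2, 1] \<longleftrightarrow> (\<exists>a b. z = [a, b] \<and> b < a)" for z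
    by (auto simp: order_iso_Cons_right)
  show ?thesis unfolding contains_iff iso by blast
qed

lemma sorted_pair:
  assumes "sorted s" and "subseq [c, d] s"
  shows "c \<le> d"
proof -
  from assms(2) obtain us vs where "s = us @ c # vs" "subseq [d] vs"
    by (blast dest: list_emb_ConsD)
  with assms(1) show ?thesis by (auto simp: sorted_append subseq_singleton_left)
qed

text \<open>
  The \<open>21\<close>-stack increases from top to bottom, so the letters smaller than
  \<open>a\<close> form an initial segment, and exactly these are popped.
\<close>

lemma pop_for_21:
  assumes "sorted s"
  shows "\<exists>p r. pop_for [2, 1] a s = (p, r) \<and> s = p @ r \<and> (\<forall>t\<in>set p. t < a) \<and> sorted (a # r)"
  using assms
proof (induction s)
  case (Cons t s)
  have c: "contains (a # t # s) [2, 1] \<longleftrightarrow> t < a"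
  proof
    assume "contains (a # t # s) [2, 1]"
    then obtain c d where cd: "subseq [c, d] (a # t # s)" "d < c" unfolding contains_21 by blast
    then have "c = a \<and> d \<in> set (t # s)"
      using subseq_pair_Cons_iff[THEN iffD1, OF cd(1)] sorted_pair[OF Cons.prems, of c d] by force
    with cd(2) Cons.prems show "t < a" by auto
  next
    assume "t < a"
    moreover have "subseq [a, t] (a # t # s)" by (simp add: subseq_Cons2)
    ultimately show "contains (a # t # s) [2, 1]" unfolding contains_21 by blast
  qed
  show ?case
  proof (cases "t < a")
    case True
    from Cons obtain p r where "pop_for [2, 1] a s = (p, r)" "s = p @ r" "\<forall>t\<in>set p. t < a" "sorted (a # r)"
      by auto
    with True show ?thesis using c
      by (intro exI[of _ "t # p"] exI[of _ r]) (simp only: pop_for.simps, simp)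
  next
    case False
    then have "pop_for [2, 1] a (t # s) = ([], t # s)" using c pop_for_none by blast
    with False Cons.prems show ?thesis by auto
  qed
qed simp

text \<open>
  Knuth's criterion for stack sorting, generalised from the empty stack so that it can be proved
  by induction on the input. For a letter \<open>b\<close> already on the stack, only the later
  letters \<open>c\<close> and \<open>a\<close> of the pattern \<open>231\<close> are searched
  for in the input; two letters on the stack cannot play \<open>b\<close> and \<open>c\<close>,
  because the deeper one is at least as large.
\<close>

lemma sorted_stack_run_21:
  assumes "sorted s"
  shows "sorted (stack_run [2, 1] s w) \<longleftrightarrow>
    \<not> (\<exists>b c a. (subseq [b, c, a] w \<or> b \<in> set s \<and> subseq [c, a] w) \<and> a < b \<and> b < c)"
    (is "_ \<longleftrightarrow> \<not> ?bad s w")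
  using assms
proof (induction w arbitrary: s)
  case Nil
  then show ?case by simp
next
  case (Cons k w)
  from pop_for_21[OF Cons.prems] obtain p r where pr: "pop_for [2, 1] k s = (p, r)"
    and s: "s = p @ r" and p: "\<forall>t\<in>set p. t < k" and r: "sorted (k # r)" by blast
  have "sorted (stack_run [2, 1] s (k # w)) \<longleftrightarrow>
      sorted (p @ stack_run [2, 1] (k # r) w)"
    unfolding stack_run_Cons pr by simp
  also have "\<dots> \<longleftrightarrow> \<not> ?bad (k # r) w \<and> (\<forall>t\<in>set p. \<forall>e\<in>set w. t \<le> e)"
    using Cons.IH[OF r] Cons.prems p
    by (auto simp: s sorted_append set_stack_run less_imp_le)
  also have "\<dots> \<longleftrightarrow> \<not> ?bad s (k # w)"
  proof -
    have if_later: "?bad s (k # w)" if "?bad (k # r) w"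
    proof -
      from that obtain b c a where bca: "a < b" "b < c"
        "subseq [b, c, a] w \<or> b = k \<and> subseq [c, a] w \<or> b \<in> set r \<and> subseq [c, a] w" by auto
      then have "subseq [b, c, a] (k # w) \<or> b \<in> set s \<and> subseq [c, a] (k # w)"
        unfolding subseq_Cons_iff s by auto
      with bca show ?thesis by blast
    qed
    have if_popped: "?bad s (k # w)" if te: "t \<in> set p" "e \<in> set w" "e < t" for t e
    proof -
      have "t \<in> set s \<and> subseq [k, e] (k # w)"
        using te by (simp add: s subseq_singleton_left)
      with te p show ?thesis by blast
    qed
    have only_if: "?bad (k # r) w \<or> (\<exists>t\<in>set p. \<exists>e\<in>set w. e < t)" if bad: "?bad s (k # w)"
    proof -
      from bad obtain b c a where bca: "a < b" "b < c"
        "subseq [b, c, a] (k # w) \<or> b \<in> set s \<and> subseq [c, a] (k # w)" by blast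
      then consider "subseq [b, c, a] w" | "b = k" "subseq [c, a] w"
        | "b \<in> set s" "c = k" "a \<in> set w" | "b \<in> set s" "subseq [c, a] w"
        unfolding subseq_Cons_iff subseq_singleton_left by blast
      then show ?thesis
      proof cases
        case 3
        with bca r have "b \<in> set p" by (auto simp: s)
        with 3 bca show ?thesis by blast
      next
        case 4
        moreover from 4 have "a \<in> set w" by (auto dest: set_subset_if_subseq)
        ultimately show ?thesis using bca by (auto simp: s)
      qed (use bca in auto)
    qed
    have "?bad s (k # w) \<longleftrightarrow> ?bad (k # r) w \<or> (\<exists>t\<in>set p. \<exists>e\<in>set w. e < t)"
    proof
      assume "?bad s (k # w)"
      then show "?bad (k # r) w \<or> (\<exists>t\<in>set p. \<exists>e\<in>set w. e < t)" by (rule only_if)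
    next
      assume "?bad (k # r) w \<or> (\<exists>t\<in>set p. \<exists>e\<in>set w. e < t)"
      then show "?bad s (k # w)"
      proof
        assume "?bad (k # r) w"
        then show ?thesis by (rule if_later)
      next
        assume "\<exists>t\<in>set p. \<exists>e\<in>set w. e < t"
        then obtain t e where "t \<in> set p" "e \<in> set w" "e < t" by blast
        then show ?thesis by (rule if_popped)
      qed
    qed
    moreover have "(\<forall>t\<in>set p. \<forall>e\<in>set w. t \<le> e) \<longleftrightarrow> \<not> (\<exists>t\<in>set p. \<exists>e\<in>set w. e < t)"
      by (auto simp: not_less)
    ultimately show ?thesis by argo
  qed
  finally show ?case .
qed

lemma sorted_stack_output_21:
  "sorted (stack_output [2, 1] w) \<longleftrightarrow> \<not> (\<exists>b c a. subseq [b, c, a] w \<and> a < b \<and> b < c)"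
  unfolding stack_output_def using sorted_stack_run_21[of "[]" w] by simp

text \<open>
  The bottom of the stack is always \<open>1\<close>. It can be popped only if
  \<open>\<sigma>\<close> is \<open>11\<close> or \<open>12\<close>, hence only by a letter that
  is at most \<open>1\<close>, and this letter becomes the new bottom.
\<close>

lemma last_output:
  assumes \<sigma>: "\<sigma> \<in> ascent_sequences" "2 \<le> length \<sigma>"
    and "\<forall>a\<in>set \<pi>. 1 \<le> a" and "s \<noteq> [] \<and> last s = 1 \<or> s = [] \<and> \<pi> \<noteq> [] \<and> hd \<pi> = 1"
  shows "stack_run \<sigma> s \<pi> \<noteq> [] \<and> last (stack_run \<sigma> s \<pi>) = 1"
  using assms(3,4)
proof (induction \<pi> arbitrary: s)
  case (Cons k \<pi>)
  let ?r = "snd (pop_for \<sigma> k s)"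
  have "last (k # ?r) = 1"
  proof (cases "?r = []")
    case False
    then have "last ?r = last s" and "s \<noteq> []"
      using pop_for_append[of \<sigma> k s] by (metis last_appendR, auto)
    with Cons.prems False show ?thesis by simp
  next
    case True
    have "k = 1"
    proof (cases "s = []")
      case False
      from True \<open>s \<noteq> []\<close> have "contains [k, last s] \<sigma>" by (rule pop_for_everything)
      moreover from Cons.prems False have "last s = 1" by simp
      ultimately obtain z where z: "subseq z [k, 1]" "order_iso z \<sigma>" by (auto simp: contains_iff)
      have "length z = length \<sigma>" using z(2) by (simp add: order_iso_def)
      with z(1) \<sigma>(2) have "z = [k, 1]"
        by (intro subseq_same_length) (auto dest: list_emb_length)
      obtain b \<tau> where "\<sigma> = 1 # b # \<tau>"
        using \<sigma> hd_ascent by (cases \<sigma>; cases "tl \<sigma>") fastforce+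
      moreover from this have "1 \<le> b" using ascent_pos[OF \<sigma>(1)] by auto
      ultimately have "k \<le> 1" using z(2) \<open>z = [k, 1]\<close> by (auto simp: not_less[symmetric])
      with Cons.prems(1) show ?thesis by simp
    qed (use Cons.prems in simp)
    with True show ?thesis by simp
  qed
  with Cons.IH[of "k # ?r"] Cons.prems show ?case by (auto simp: stack_run_Cons)
qed auto

text \<open>
  The final \<open>1\<close> of the output completes every inversion \<open>y\<close>,
  \<open>z\<close> with \<open>2 \<le> y\<close> to a pattern \<open>231\<close>, and conversely
  the first letter of a pattern \<open>231\<close> is at least \<open>2\<close> because the last
  one is at least \<open>1\<close>.
\<close>

lemma stack_sortable_iff:
  assumes \<sigma>: "\<sigma> \<in> ascent_sequences" "2 \<le> length \<sigma>" and \<pi>: "\<pi> \<in> ascent_sequences"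
  shows "stack_sortable \<sigma> \<pi> \<longleftrightarrow>
    \<not> (\<exists>y z. subseq [y, z] (stack_output \<sigma> \<pi>) \<and> 2 \<le> y \<and> y < z)"
proof -
  let ?w = "stack_output \<sigma> \<pi>"
  have set: "set ?w = set \<pi>" by (simp add: stack_output_def set_stack_run)
  have "?w \<noteq> [] \<and> last ?w = 1"
    unfolding stack_output_def using hd_ascent[OF \<pi>] ascent_pos[OF \<pi>]
    by (intro last_output[OF \<sigma>]) auto
  then obtain w where w: "?w = w @ [1]" by (metis append_butlast_last_id)
  have "(\<exists>b c a. subseq [b, c, a] ?w \<and> a < b \<and> b < c) \<longleftrightarrow>
      (\<exists>y z. subseq [y, z] ?w \<and> 2 \<le> y \<and> y < z)" (is "?L \<longleftrightarrow> ?R")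
  proof
    assume ?L
    then obtain b c a where bca: "subseq [b, c, a] ?w" "a < b" "b < c" by blast
    then have "a \<in> set ?w" by (auto dest: set_subset_if_subseq)
    then have "1 \<le> a" using ascent_pos[OF \<pi>] set by blast
    moreover from bca(1) have "subseq [b, c] ?w"
      using subseq_order.trans[of "[b, c]" "[b, c, a]"] by (simp add: subseq_Cons2)
    ultimately show ?R using bca by (intro exI[of _ b] exI[of _ c]) simp
  next
    assume ?R
    then obtain y z where yz: "subseq [y, z] ?w" "2 \<le> y" "y < z" by blast
    then have "subseq [y, z] w" using subseq_pair_append_iff[of y z w "[1]"] by (auto simp: w)
    then have "subseq ([y, z] @ [1]) ?w" unfolding w by (rule list_emb_append_mono) simp
    with yz show ?L by (intro exI[of _ y] exI[of _ z] exI[of _ 1]) simp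
  qed
  then show ?thesis unfolding stack_sortable_def sorted_stack_output_21 by blast
qed

section \<open>Ascent sequences avoiding 1213\<close>

lemma asc_snoc:
  assumes "x \<noteq> []"
  shows "asc (x @ [a]) = asc x + (if last x < a then 1 else 0)"
proof -
  let ?J = "{j. Suc j < length x \<and> x ! j < x ! Suc j}"
  have "{j. Suc j < length (x @ [a]) \<and> (x @ [a]) ! j < (x @ [a]) ! Suc j} =
      ?J \<union> (if last x < a then {length x - 1} else {})"
  proof (rule set_eqI)
    fix j
    consider "Suc j < length x" | "Suc j = length x" | "length x < Suc j" by linarith
    then show "j \<in> {j. Suc j < length (x @ [a]) \<and> (x @ [a]) ! j < (x @ [a]) ! Suc j} \<longleftrightarrow>
        j \<in> ?J \<union> (if last x < a then {length x - 1} else {})"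
    proof cases
      case 2
      then have "last x = x ! j" using assms by (metis diff_Suc_1 last_conv_nth)
      with 2 show ?thesis by (auto simp: nth_append)
    qed (use assms in \<open>auto simp: nth_append\<close>)
  qed
  moreover have "finite ?J" by (rule finite_subset[of _ "{..<length x}"]) auto
  moreover have "length x - 1 \<notin> ?J" using assms by (cases x) auto
  ultimately show ?thesis by (simp add: asc_def)
qed

text \<open>
  Up to a letter \<open>x ! p\<close> that exceeds all earlier ones, the word climbs weakly
  without gaps. A descent to \<open>a\<close> would repeat a letter \<open>a\<close> that was
  already passed on the way to the current maximum \<open>m\<close>, and then \<open>a m a (x !
  p)\<close> is a \<open>1213\<close>. Without descents, the number of ascents is one less than
  the maximum, so the bound for ascent sequences allows a step of at most one.
\<close>

lemma staircase_before_strict_maximum: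
  assumes x: "x \<in> ascent_sequences" and av: "\<not> contains x [1, 2, 1, 3]"
    and p: "p < length x" "\<forall>i<p. x ! i < x ! p" and n: "1 \<le> n" "n \<le> p"
  shows "sorted (take n x) \<and> set (take n x) = {1..Suc (asc (take n x))}"
  using n
proof (induction n rule: nat_induct_at_least)
  case base
  from hd_ascent[OF x] show ?case by (auto simp: asc_def)
next
  case (Suc n)
  let ?w = "take n x" and ?a = "x ! n" and ?m = "Suc (asc (take n x))"
  from Suc p have n: "1 \<le> n" "n < p" "n < length x" and w: "sorted ?w" "set ?w = {1..?m}" by auto
  have take: "take (Suc n) x = ?w @ [?a]" using n by (simp add: take_Suc_conv_app_nth)
  have ne: "?w \<noteq> []" using n by auto
  have "?a \<le> Suc ?m" using x n by (simp add: ascent_sequences_def)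
  have "last ?w \<in> set ?w" using ne by simp
  moreover have "?m \<in> set ?w" using w by simp
  then have "?m \<le> last ?w"
    using w(1) by (cases ?w rule: rev_cases) (auto simp: sorted_append)
  ultimately have last: "last ?w = ?m" using w(2) by auto
  have "?m \<le> ?a"
  proof (rule ccontr)
    assume less: "\<not> ?m \<le> ?a"
    have "1 \<le> ?a" using ascent_pos[OF x] n by simp
    with less w(2) have "?a \<in> set (butlast ?w @ [?m])" using last ne
      by (metis append_butlast_last_id atLeastAtMost_iff nat_le_linear)
    with less have "?a \<in> set (butlast ?w)" by auto
    then have "subseq ([?a] @ [?m]) (butlast ?w @ [last ?w])"
      by (intro list_emb_append_mono) (auto simp: subseq_singleton_left last)
    then have "subseq [?a, ?m] ?w" using ne by simp
    moreover have "x ! p \<in> set (drop (Suc n) x)"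
      using n p(1) by (auto simp: in_set_conv_nth intro!: exI[of _ "p - Suc n"])
    ultimately have "subseq ([?a, ?m] @ [?a] @ [x ! p]) (?w @ [?a] @ drop (Suc n) x)"
      by (intro list_emb_append_mono) (simp_all add: subseq_singleton_left)
    then have "subseq [?a, ?m, ?a, x ! p] x" using n(3) by (simp add: id_take_nth_drop[symmetric])
    moreover have "?m < x ! p"
    proof -
      obtain i where "i < length ?w" "?w ! i = ?m" using \<open>?m \<in> set ?w\<close> by (auto simp: in_set_conv_nth)
      then have "x ! i = ?m" "i < p" using n by simp_all
      then show ?thesis using p(2) by metis
    qed
    ultimately show False using av less unfolding contains_1213 by (meson not_le)
  qed
  have srt: "sorted (?w @ [?a])" using w \<open>?m \<le> ?a\<close> by (auto simp: sorted_append)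
  have asc: "asc (?w @ [?a]) = asc ?w + (if ?m < ?a then 1 else 0)"
    using asc_snoc[OF ne] last by simp
  from \<open>?m \<le> ?a\<close> \<open>?a \<le> Suc ?m\<close> consider "?a = ?m" | "?a = Suc ?m" by linarith
  then have "set (?w @ [?a]) = {1..Suc (asc (?w @ [?a]))}"
  proof cases
    case 1
    then have "asc (?w @ [?a]) = asc ?w" using asc by simp
    moreover have "set (?w @ [?a]) = set ?w" using \<open>?m \<in> set ?w\<close> unfolding 1[symmetric] by auto
    ultimately show ?thesis using w(2) by argo
  next
    case 2
    then have "asc (?w @ [?a]) = ?m" using asc by simp
    moreover have "set (?w @ [?a]) = insert (Suc ?m) {1..?m}" unfolding 2 w(2)[symmetric] by simp
    moreover have "insert (Suc ?m) {1..?m} = {1..Suc ?m}" by (simp add: atLeastAtMostSuc_conv)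
    ultimately show ?thesis by argo
  qed
  with srt show ?case unfolding take by blast
qed

text \<open>
  The first letter above \<open>y\<close> exceeds everything before it. The word climbs to it
  through all smaller values, and \<open>y\<close> is one of them.
\<close>

lemma smaller_letters_occur_before:
  assumes x: "x \<in> ascent_sequences" and av: "\<not> contains x [1, 2, 1, 3]"
    and split: "x = \<alpha> @ b # \<beta>" and y: "1 \<le> y" "y < b"
  shows "y \<in> set \<alpha>"
proof -
  define p where "p = (LEAST i. y < x ! i)"
  have "y < x ! length \<alpha>" using split y by simp
  then have p: "y < x ! p" "p \<le> length \<alpha>" unfolding p_def by (rule LeastI, rule Least_le)
  have before: "x ! i \<le> y" if "i < p" for i
    using not_less_Least[of i "\<lambda>i. y < x ! i"] that unfolding p_def by simp
  have "x ! 0 = 1" using x by (simp add: ascent_sequences_def)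
  with p(1) y(1) have "p \<noteq> 0" by (metis not_le)
  have pl: "p < length x" using p(2) split by simp
  have max: "\<forall>i<p. x ! i < x ! p" using before p(1) le_less_trans by blast
  have "set (take p x) = {1..Suc (asc (take p x))}"
    using staircase_before_strict_maximum[OF x av pl max] \<open>p \<noteq> 0\<close> by simp
  moreover have "x ! p \<le> 2 + asc (take p x)"
    using x pl \<open>p \<noteq> 0\<close> by (simp add: ascent_sequences_def)
  ultimately have "y \<in> set (take p x)" using p(1) y(1) by simp
  also have "take p x = take p \<alpha>" using p(2) split by simp
  finally show ?thesis by (rule in_set_takeD)
qed

section \<open>The three exceptional classes\<close>

lemma class_if_sortable_iff_avoids:
  assumes "\<And>x. x \<in> ascent_sequences \<Longrightarrow> stack_sortable \<sigma> x \<longleftrightarrow> (\<forall>p\<in>P. \<not> contains x p)"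
  shows "is_class (sortable_ascent_sequences \<sigma>)"
  unfolding is_class_def
proof (intro conjI ballI impI)
  fix x y
  assume "x \<in> sortable_ascent_sequences \<sigma>" and y: "y \<in> ascent_sequences" and "contains x y"
  then have "\<forall>p\<in>P. \<not> contains x p" using assms[of x] by (simp add: sortable_ascent_sequences_def)
  with \<open>contains x y\<close> have "\<forall>p\<in>P. \<not> contains y p" by (blast intro: contains_trans)
  with y show "y \<in> sortable_ascent_sequences \<sigma>"
    using assms[OF y] by (simp add: sortable_ascent_sequences_def)
qed (auto simp: sortable_ascent_sequences_def)

lemma popped_before_later_input:
  assumes "y \<in> set (output_after \<sigma> s \<pi>)" and "z \<in> set \<rho>"
  shows "subseq [y, z] (stack_run \<sigma> s (\<pi> @ \<rho>))"
  unfolding stack_run_append subseq_pair_append_iff set_stack_run using assms by blast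

text \<open>
  The \<open>12\<close>-stack decreases weakly from top to bottom, so no letter is pushed onto a
  larger one, and a pop of \<open>y\<close> is caused by a smaller letter \<open>a\<close>. An
  inversion \<open>y\<close>, \<open>z\<close> of the output thus means \<open>y a z\<close> in
  the input. Conversely a smaller letter \<open>a\<close> drives out every copy of
  \<open>y\<close> before \<open>z\<close> comes.
\<close>

lemma sortable_12_iff:
  assumes x: "x \<in> ascent_sequences"
  shows "stack_sortable [1, 2] x \<longleftrightarrow> \<not> contains x [2, 1, 3]"
proof -
  have \<sigma>: "[1, 2] \<in> ascent_sequences" "2 \<le> length [1::nat, 2]"
    by (auto simp: ascent_sequences_def less_Suc_eq)
  note av = stack_avoids[OF empty_stack_avoids[OF \<sigma>(2)] \<sigma>(2)]
  have "(\<exists>y z. subseq [y, z] (stack_output [1, 2] x) \<and> 2 \<le> y \<and> y < z) \<longleftrightarrow> contains x [2, 1, 3]"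
  proof
    assume "\<exists>y z. subseq [y, z] (stack_output [1, 2] x) \<and> 2 \<le> y \<and> y < z"
    then obtain y z where yz: "subseq [y, z] (stack_output [1, 2] x)" "2 \<le> y" "y < z" by blast
    from inversion_in_output[OF yz(1)] show "contains x [2, 1, 3]"
    proof (elim disjE exE conjE)
      fix \<alpha> k \<beta>
      assume split: "x = \<alpha> @ k # \<beta>" and z: "z \<in> set (k # \<beta>)"
        and "y \<in> set (fst (pop_for [1, 2] k (stack_after [1, 2] [] \<alpha>)))"
      with pop_for_popped obtain u v where s: "stack_after [1, 2] [] \<alpha> = u @ y # v"
        and c: "contains (k # y # v) [1, 2]" by blast
      have "y \<in> set \<alpha>" using set_output_stack[of "[1, 2]" "[]" \<alpha>] s by auto
      have no: "\<not> (a < b \<and> subseq [a, b] (y # v))" for a b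
        using av[of \<alpha>] unfolding s contains_12 by (meson list_emb_append2)
      from c obtain a b where "a < b" "subseq [a, b] (k # y # v)" unfolding contains_12 by blast
      with no have b: "a = k" "b \<in> set (y # v)" unfolding subseq_pair_Cons_iff[of a b k] by blast+
      have "b \<le> y" using b(2) no[of y b] by (auto simp: subseq_singleton_left)
      with b \<open>a < b\<close> yz z have "k < y" "z \<in> set \<beta>" by auto
      then have "subseq ([y] @ [k] @ [z]) (\<alpha> @ [k] @ \<beta>)" using \<open>y \<in> set \<alpha>\<close>
        by (intro list_emb_append_mono) (simp_all add: subseq_singleton_left)
      then show ?thesis using \<open>k < y\<close> yz(3) unfolding contains_213 split
        by (intro exI[of _ y] exI[of _ k] exI[of _ z]) simp
    next
      fix \<alpha> \<beta> s
      assume "stack_after [1, 2] [] \<alpha> = y # s" "z \<in> set s"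
      with av[of \<alpha>] have "\<not> (\<exists>a b. subseq [a, b] (y # s) \<and> a < b)" unfolding contains_12 by simp
      moreover have "subseq [y, z] (y # s)" using \<open>z \<in> set s\<close> by (simp add: subseq_singleton_left)
      ultimately show ?thesis using yz(3) by blast
    qed
  next
    assume "contains x [2, 1, 3]"
    then obtain y a z where yaz: "subseq [y, a, z] x" "a < y" "y < z" unfolding contains_213 by blast
    then obtain u v w where x': "x = (u @ y # v @ [a]) @ w" "z \<in> set w"
      by (fastforce dest!: list_emb_ConsD simp: subseq_singleton_left)
    let ?\<pi> = "u @ y # v @ [a]"
    obtain r where r: "stack_after [1, 2] [] ?\<pi> = a # r"
      using stack_after_snoc[of "[1, 2]" "[]" "u @ y # v" a] by simp
    have "y \<notin> set r"
    proof
      assume "y \<in> set r"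
      then have "subseq [a, y] (a # r)" by (simp add: subseq_singleton_left)
      then show False using av[of ?\<pi>] yaz(2) unfolding r contains_12 by blast
    qed
    moreover have "y \<in> set (output_after [1, 2] [] ?\<pi>) \<union> set (a # r)"
      using set_output_stack[of "[1, 2]" "[]" ?\<pi>] unfolding r by simp
    ultimately have "y \<in> set (output_after [1, 2] [] ?\<pi>)" using yaz(2) by auto
    then have "subseq [y, z] (stack_output [1, 2] x)"
      unfolding stack_output_def x'(1) using x'(2) by (rule popped_before_later_input)
    moreover have "2 \<le> y"
    proof -
      have "1 \<le> a" using ascent_pos[OF x, of a] x'(1) by simp
      with yaz(2) show ?thesis by simp
    qed
    ultimately show "\<exists>y z. subseq [y, z] (stack_output [1, 2] x) \<and> 2 \<le> y \<and> y < z"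
      using yaz(3) by blast
  qed
  with stack_sortable_iff[OF \<sigma> x] show ?thesis by blast
qed

text \<open>
  The three alternatives are the three ways in which the descent below proceeds: the first two
  give the patterns \<open>1213\<close> and \<open>1223\<close> together with a later larger
  letter, the third one leads to an earlier time.
\<close>

lemma popped_letter_has_larger_below:
  assumes \<sigma>: "\<sigma> = [1, 1] \<or> \<sigma> = [1, 2, 1]"
    and av: "\<not> contains (u @ y # v) \<sigma>" and c: "contains (k # y # v) \<sigma>"
  shows "k < y \<and> k \<in> set v \<or> k = y \<and> \<sigma> = [1, 1] \<or> (\<exists>b\<in>set v. y < b)"
  using \<sigma>
proof
  assume \<sigma>: "\<sigma> = [1, 1]"
  from c obtain a where a: "subseq [a, a] (k # y # v)" unfolding \<sigma> contains_11 by blast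
  have "\<not> subseq [a, a] (y # v)"
    using av unfolding \<sigma> contains_11 by (meson list_emb_append2)
  with a have "k \<in> set (y # v)" unfolding subseq_pair_Cons_iff[of a a k] by blast
  with \<sigma> show ?thesis by (cases k y rule: linorder_cases) auto
next
  assume \<sigma>: "\<sigma> = [1, 2, 1]"
  from c obtain a b where ab: "a < b" "subseq [a, b, a] (k # y # v)" unfolding \<sigma> contains_121 by blast
  have "\<not> subseq [a, b, a] (y # v)"
    using av ab(1) unfolding \<sigma> contains_121 by (meson list_emb_append2)
  with ab have k: "k < b" "subseq [b, k] (y # v)"
    unfolding subseq_Cons_iff[of a "[b, a]" k] by blast+
  then have "b \<in> set (y # v)" "k \<in> set v" unfolding subseq_pair_Cons_iff[of b k y]
    using set_subset_if_subseq[of "[b, k]" v] by auto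
  with k(1) show ?thesis by (cases k y rule: linorder_cases) auto
qed

lemma repeat_around_larger_contains:
  assumes \<sigma>: "\<sigma> = [1, 1] \<or> \<sigma> = [1, 2, 1]" and "subseq [a, b, a] w" and "a < b"
  shows "contains w \<sigma>"
proof -
  have "subseq [a, a] [a, b, a]" by simp
  with assms(2) have "subseq [a, a] w" using subseq_order.trans by blast
  with assms show ?thesis using contains_11 contains_121 by blast
qed

text \<open>
  The descent step. A copy of \<open>y\<close> occurs before \<open>b\<close> in the input. When
  \<open>b\<close> is pushed this copy is no longer on the stack, as otherwise this copy,
  \<open>b\<close> and the later \<open>y\<close> would form \<open>y b y\<close> there. It was
  thus popped before \<open>b\<close> entered, which is the situation of
  \<open>no_early_pop\<close> for \<open>y\<close> and \<open>b\<close> at a shorter prefix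
  \<open>\<alpha>'\<close>.
\<close>

lemma larger_letter_below_was_early_pop:
  assumes \<sigma>: "\<sigma> = [1, 1] \<or> \<sigma> = [1, 2, 1]"
    and x: "x \<in> ascent_sequences" "\<not> contains x [1, 2, 1, 3]"
    and split: "x = \<alpha> @ \<beta>" and s: "stack_after \<sigma> [] \<alpha> = u @ y # v"
    and b: "b \<in> set v" "1 \<le> y" "y < b"
  shows "\<exists>\<alpha>' k \<beta>'. x = \<alpha>' @ k # \<beta>' \<and> length \<alpha>' < length \<alpha> \<and>
    y \<in> set (fst (pop_for \<sigma> k (stack_after \<sigma> [] \<alpha>'))) \<and> b \<in> set (k # \<beta>')"
proof -
  have \<sigma>2: "2 \<le> length \<sigma>" using \<sigma> by auto
  from b(1) obtain v' w where v: "v = v' @ b # w" by (meson split_list)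
  from pushed_moment[of \<sigma> \<alpha> "u @ y # v'" b w] s v obtain \<gamma> \<delta>
    where \<alpha>: "\<alpha> = \<gamma> @ b # \<delta>" and sb: "stack_after \<sigma> [] (\<gamma> @ [b]) = b # w" by auto
  have "y \<in> set \<gamma>"
    using smaller_letters_occur_before[OF x, of \<gamma> b "\<delta> @ \<beta>"] split \<alpha> b by simp
  have "y \<notin> set w"
  proof
    assume "y \<in> set w"
    then have "subseq ([] @ [y] @ [] @ [b] @ [y]) (u @ [y] @ v' @ [b] @ w)"
      by (intro list_emb_append_mono) (simp_all add: subseq_singleton_left)
    then have "contains (stack_after \<sigma> [] \<alpha>) \<sigma>"
      using repeat_around_larger_contains[OF \<sigma>, of y b] b(3) by (simp add: s v)
    with stack_avoids[OF empty_stack_avoids[OF \<sigma>2] \<sigma>2] show False by blast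
  qed
  with \<open>y \<in> set \<gamma>\<close> b(3) have "y \<in> set (output_after \<sigma> [] (\<gamma> @ [b]))"
    using set_output_stack[of \<sigma> "[]" "\<gamma> @ [b]"] unfolding sb by auto
  from popped_moment[OF this] obtain \<alpha>' k \<beta>' where m: "\<gamma> @ [b] = \<alpha>' @ k # \<beta>'"
    "y \<in> set (fst (pop_for \<sigma> k (stack_after \<sigma> [] \<alpha>')))" by blast
  have "b = last (k # \<beta>')" using m(1) by (metis last_appendR last_snoc list.distinct(1))
  then have "b \<in> set (k # \<beta>')" using last_in_set by blast
  moreover have "length \<alpha>' < length \<alpha>"
    using arg_cong[OF m(1), of length] by (simp add: \<alpha>)
  moreover have "x = \<alpha>' @ k # (\<beta>' @ \<delta> @ \<beta>)"
    using arg_cong[OF m(1), of "\<lambda>l. l @ \<delta> @ \<beta>"] by (simp add: split \<alpha>)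
  ultimately show ?thesis using m(2)
    by (intro exI[of _ \<alpha>'] exI[of _ k] exI[of _ "\<beta>' @ \<delta> @ \<beta>"]) auto
qed

text \<open>
  Infinite descent on the moment \<open>\<alpha>\<close> of the pop.
\<close>

lemma no_early_pop:
  assumes \<sigma>: "\<sigma> = [1, 1] \<or> \<sigma> = [1, 2, 1]"
    and x: "x \<in> ascent_sequences" "\<not> contains x [1, 2, 1, 3]"
    and av1223: "\<sigma> = [1, 1] \<Longrightarrow> \<not> contains x [1, 2, 2, 3]"
    and split: "x = \<alpha> @ k # \<beta>" and y: "y \<in> set (fst (pop_for \<sigma> k (stack_after \<sigma> [] \<alpha>)))" "2 \<le> y"
    and z: "z \<in> set (k # \<beta>)"
  shows "\<not> y < z"
  using split y z
proof (induction "length \<alpha>" arbitrary: \<alpha> k \<beta> z rule: less_induct)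
  case less
  note split = less.prems(1)
  have \<sigma>2: "2 \<le> length \<sigma>" using \<sigma> by auto
  from pop_for_popped[OF less.prems(2)] obtain u v where s: "stack_after \<sigma> [] \<alpha> = u @ y # v"
    and c: "contains (k # y # v) \<sigma>" by blast
  have sub: "subseq (rev v @ [y] @ rev u) \<alpha>"
    using subseq_rev_stack[of \<sigma> "[]" \<alpha>] by (simp add: s)
  then have "y \<in> set \<alpha>" by (auto dest: set_subset_if_subseq)
  show ?case
  proof
    assume "y < z"
    have "\<not> contains (u @ y # v) \<sigma>"
      using stack_avoids[OF empty_stack_avoids[OF \<sigma>2] \<sigma>2, of \<alpha>] by (simp add: s)
    from popped_letter_has_larger_below[OF \<sigma> this c] show False
    proof (elim disjE conjE bexE)
      assume k: "k < y" "k \<in> set v"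
      have "subseq ([k] @ [y] @ []) (rev v @ [y] @ rev u)"
        using k(2) by (intro list_emb_append_mono) (simp_all add: subseq_singleton_left)
      with sub have "subseq [k, y] \<alpha>" using subseq_order.trans by fastforce
      moreover have "z \<in> set \<beta>" using k(1) \<open>y < z\<close> less.prems(4) by auto
      ultimately have "subseq ([k, y] @ [k] @ [z]) (\<alpha> @ [k] @ \<beta>)"
        by (intro list_emb_append_mono) (simp_all add: subseq_singleton_left)
      then have "subseq [k, y, k, z] x" by (simp add: split)
      with x(2) k(1) \<open>y < z\<close> show False unfolding contains_1213 by blast
    next
      assume k: "k = y" "\<sigma> = [1, 1]"
      obtain \<alpha>' where \<alpha>: "\<alpha> = 1 # \<alpha>'"
        using hd_ascent[OF x(1)] split \<open>y \<in> set \<alpha>\<close> by (cases \<alpha>) auto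
      with \<open>y \<in> set \<alpha>\<close> less.prems(3) have "subseq [1, y] \<alpha>" by (auto simp: subseq_singleton_left)
      moreover have "z \<in> set \<beta>" using k(1) \<open>y < z\<close> less.prems(4) by auto
      ultimately have "subseq ([1, y] @ [k] @ [z]) (\<alpha> @ [k] @ \<beta>)"
        by (intro list_emb_append_mono) (simp_all add: subseq_singleton_left)
      then have "subseq [1, y, y, z] x" by (simp add: split k(1))
      moreover have "1 < y" using less.prems(3) by simp
      ultimately show False using av1223[OF k(2)] \<open>y < z\<close> unfolding contains_1223 by blast
    next
      fix b assume b: "b \<in> set v" "y < b"
      from less.prems(3) have "1 \<le> y" by simp
      \<comment> \<open>The induction hypothesis applies to the pair \<open>y\<close>, \<open>b\<close> at the shorter prefix.\<close>
      from larger_letter_below_was_early_pop[OF \<sigma> x split s b(1) this b(2)] less.hyps less.prems(3) b(2)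
      show False by blast
    qed
  qed
qed

lemma no_inversion_if_avoids:
  assumes \<sigma>: "\<sigma> = [1, 1] \<or> \<sigma> = [1, 2, 1]"
    and x: "x \<in> ascent_sequences" "\<not> contains x [1, 2, 1, 3]"
    and av1223: "\<sigma> = [1, 1] \<Longrightarrow> \<not> contains x [1, 2, 2, 3]"
    and yz: "subseq [y, z] (stack_output \<sigma> x)" "2 \<le> y"
  shows "\<not> y < z"
  using inversion_in_output[OF yz(1)]
proof (elim disjE exE conjE)
  fix \<alpha> k \<beta>
  assume "x = \<alpha> @ k # \<beta>" "y \<in> set (fst (pop_for \<sigma> k (stack_after \<sigma> [] \<alpha>)))" "z \<in> set (k # \<beta>)"
  then show ?thesis using no_early_pop[OF \<sigma> x av1223] yz(2) by blast
next
  fix \<alpha> \<beta> s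
  assume split: "x = \<alpha> @ \<beta>" and s: "stack_after \<sigma> [] \<alpha> = y # s" "z \<in> set s"
  show ?thesis
  proof
    assume "y < z"
    moreover have "1 \<le> y" using yz(2) by simp
    ultimately show False
      using larger_letter_below_was_early_pop[OF \<sigma> x split, of "[]" y s z] s
        no_early_pop[OF \<sigma> x av1223] yz(2) by auto
  qed
qed

text \<open>
  Consider the moment when \<open>y\<close> of an occurrence \<open>a y a z\<close> is pushed. If
  \<open>a\<close> is on the stack then, \<open>y\<close> has to leave before the second
  \<open>a\<close> is pushed, since \<open>a y a\<close> is forbidden on the stack; so
  \<open>y\<close> precedes \<open>z\<close> in the output. Otherwise \<open>a\<close> has
  already left, so \<open>a\<close> precedes \<open>z\<close>; moreover \<open>a \<noteq>
  1\<close> because the bottom of the stack is \<open>1\<close>.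
\<close>

lemma inversion_if_contains_1213:
  assumes \<sigma>: "\<sigma> = [1, 1] \<or> \<sigma> = [1, 2, 1]" and x: "x \<in> ascent_sequences"
    and c: "contains x [1, 2, 1, 3]"
  shows "\<exists>y z. subseq [y, z] (stack_output \<sigma> x) \<and> 2 \<le> y \<and> y < z"
proof -
  have \<sigma>2: "2 \<le> length \<sigma>" and \<sigma>A: "\<sigma> \<in> ascent_sequences"
    using \<sigma> by (auto simp: ascent_sequences_def less_Suc_eq)
  from c obtain a y z where ayz: "subseq [a, y, a, z] x" "a < y" "y < z" unfolding contains_1213 by blast
  then obtain p q r t where split: "x = ((p @ a # q) @ [y]) @ (r @ [a]) @ t" and "z \<in> set t"
    by (fastforce dest!: list_emb_ConsD simp: subseq_singleton_left)
  have pos: "1 \<le> b" if "b \<in> set x" for b using ascent_pos[OF x that] .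
  then have "1 \<le> a" using split by simp
  with ayz(2) have "2 \<le> y" by simp
  \<comment> \<open>Stop at the push of \<open>y\<close>: everything depends on whether \<open>a\<close> is below it.\<close>
  let ?\<alpha> = "p @ a # q"
  obtain s where s: "stack_after \<sigma> [] (?\<alpha> @ [y]) = y # s"
    and s': "s = snd (pop_for \<sigma> y (stack_after \<sigma> [] ?\<alpha>))"
    using stack_after_snoc[of \<sigma> "[]" ?\<alpha> y] by blast
  show ?thesis
  proof (cases "a \<in> set s")
    case True
    have "y \<in> set (output_after \<sigma> (y # s) (r @ [a]))"
      using pushed_above_or_output[of y \<sigma> s r a]
    proof
      assume "\<exists>w. stack_after \<sigma> (y # s) (r @ [a]) = a # w @ y # s"
      then obtain w where w: "stack_after \<sigma> [] ((?\<alpha> @ [y]) @ (r @ [a])) = a # w @ y # s"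
        unfolding stack_after_append[of _ _ "?\<alpha> @ [y]"] s by blast
      from True have "subseq ([a] @ [] @ [y] @ [a]) ([a] @ w @ [y] @ s)"
        by (intro list_emb_append_mono) (simp_all add: subseq_singleton_left)
      then have "contains (a # w @ y # s) \<sigma>"
        using repeat_around_larger_contains[OF \<sigma>, of a y] ayz(2) by simp
      with stack_avoids[OF empty_stack_avoids[OF \<sigma>2] \<sigma>2] w show ?thesis by metis
    qed
    then have "subseq [y, z] (stack_run \<sigma> (y # s) ((r @ [a]) @ t))"
      using \<open>z \<in> set t\<close> by (rule popped_before_later_input)
    then have "subseq [y, z] (stack_output \<sigma> x)"
      unfolding stack_output_def split stack_run_append[of _ _ "?\<alpha> @ [y]"] s
      by (rule subseq_drop_many)
    with \<open>2 \<le> y\<close> ayz(3) show ?thesis by blast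
  next
    case False
    have "a \<in> set (output_after \<sigma> [] (?\<alpha> @ [y])) \<union> set (y # s)"
      using set_output_stack[of \<sigma> "[]" "?\<alpha> @ [y]"] unfolding s by auto
    with False ayz(2) have out: "a \<in> set (output_after \<sigma> [] (?\<alpha> @ [y]))" by auto
    have "a \<noteq> 1"
    proof
      assume "a = 1"
      have "stack_run \<sigma> [] (?\<alpha> @ [y]) = output_after \<sigma> [] (?\<alpha> @ [y]) @ y # s"
        using stack_run_append[of \<sigma> "[]" "?\<alpha> @ [y]" "[]"] s by simp
      moreover have "last (stack_run \<sigma> [] (?\<alpha> @ [y])) = 1"
        using last_output[OF \<sigma>A \<sigma>2, of "?\<alpha> @ [y]" "[]"] pos hd_ascent[OF x] split
        by (cases p) auto
      ultimately have "last (y # s) = 1" by simp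
      with False \<open>a = 1\<close> ayz(2) show False using last_in_set[of s] by (cases "s = []") auto
    qed
    with \<open>1 \<le> a\<close> have "2 \<le> a" by simp
    moreover have "z \<in> set ((r @ [a]) @ t)" using \<open>z \<in> set t\<close> by simp
    then have "subseq [a, z] (stack_output \<sigma> x)"
      unfolding stack_output_def split by (rule popped_before_later_input[OF out])
    moreover have "a < z" using ayz(2,3) by simp
    ultimately show ?thesis by blast
  qed
qed

lemma inversion_if_contains_1223:
  assumes x: "x \<in> ascent_sequences" and c: "contains x [1, 2, 2, 3]"
  shows "\<exists>y z. subseq [y, z] (stack_output [1, 1] x) \<and> 2 \<le> y \<and> y < z"
proof -
  from c obtain a y z where ayz: "subseq [a, y, y, z] x" "a < y" "y < z" unfolding contains_1223 by blast
  from ayz(1) obtain p0 p1 where "x = p0 @ a # p1" "subseq [y, y, z] p1" by (blast dest: list_emb_ConsD)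
  moreover from this(2) obtain p2 r0 where "p1 = p2 @ y # r0" "subseq [y, z] r0" by (blast dest: list_emb_ConsD)
  moreover from this(2) obtain r t where "r0 = r @ y # t" "subseq [z] t" by (blast dest: list_emb_ConsD)
  ultimately obtain p r t where split: "x = (p @ [y]) @ (r @ [y]) @ t" and "z \<in> set t" "a \<in> set p"
    by (intro that[of "p0 @ a # p2" r t]) (simp_all add: subseq_singleton_left)
  have "1 \<le> a" using ascent_pos[OF x, of a] \<open>a \<in> set p\<close> split by simp
  with ayz(2) have "2 \<le> y" by simp
  obtain s where s: "stack_after [1, 1] [] (p @ [y]) = y # s"
    using stack_after_snoc by blast
  have "y \<in> set (output_after [1, 1] (y # s) (r @ [y]))"
    using pushed_above_or_output[of y "[1, 1]" s r y]
  proof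
    assume "\<exists>w. stack_after [1, 1] (y # s) (r @ [y]) = y # w @ y # s"
    then obtain w where w: "stack_after [1, 1] [] ((p @ [y]) @ (r @ [y])) = y # w @ y # s"
      unfolding stack_after_append[of _ _ "p @ [y]"] s by blast
    have "subseq ([y] @ [] @ [y] @ []) ([y] @ w @ [y] @ s)"
      by (intro list_emb_append_mono) simp_all
    then have "contains (y # w @ y # s) [1, 1]" unfolding contains_11 by auto
    with stack_avoids[OF empty_stack_avoids, of "[1, 1]"] w show ?thesis
      by (metis One_nat_def Suc_1 le_refl length_Cons list.size(3))
  qed
  then have "subseq [y, z] (stack_run [1, 1] (y # s) ((r @ [y]) @ t))"
    using \<open>z \<in> set t\<close> by (rule popped_before_later_input)
  then have "subseq [y, z] (stack_output [1, 1] x)"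
    unfolding stack_output_def split stack_run_append[of _ _ "p @ [y]"] s
    by (rule subseq_drop_many)
  with \<open>2 \<le> y\<close> ayz(3) show ?thesis by blast
qed

lemma sortable_11_iff:
  assumes "x \<in> ascent_sequences"
  shows "stack_sortable [1, 1] x \<longleftrightarrow> (\<forall>p\<in>{[1, 2, 1, 3], [1, 2, 2, 3]}. \<not> contains x p)"
proof -
  have \<sigma>: "[1, 1] \<in> ascent_sequences" "2 \<le> length [1::nat, 1]"
    by (auto simp: ascent_sequences_def less_Suc_eq)
  have "(\<exists>y z. subseq [y, z] (stack_output [1, 1] x) \<and> 2 \<le> y \<and> y < z) \<longleftrightarrow>
      contains x [1, 2, 1, 3] \<or> contains x [1, 2, 2, 3]"
    using inversion_if_contains_1213[OF disjI1[OF refl] assms] inversion_if_contains_1223[OF assms]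
      no_inversion_if_avoids[OF disjI1[OF refl] assms] by blast
  with stack_sortable_iff[OF \<sigma> assms] show ?thesis by blast
qed

lemma sortable_121_iff:
  assumes "x \<in> ascent_sequences"
  shows "stack_sortable [1, 2, 1] x \<longleftrightarrow> \<not> contains x [1, 2, 1, 3]"
proof -
  have \<sigma>: "[1, 2, 1] \<in> ascent_sequences" "2 \<le> length [1::nat, 2, 1]"
    by (auto simp: ascent_sequences_def less_Suc_eq)
  have "[1, 2, 1] \<noteq> [1, 1::nat]" by simp
  then have "(\<exists>y z. subseq [y, z] (stack_output [1, 2, 1] x) \<and> 2 \<le> y \<and> y < z) \<longleftrightarrow>
      contains x [1, 2, 1, 3]"
    using inversion_if_contains_1213[OF disjI2[OF refl] assms]
      no_inversion_if_avoids[OF disjI2[OF refl] assms] by blast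
  with stack_sortable_iff[OF \<sigma> assms] show ?thesis by blast
qed

lemma is_class_11_12_121:
  assumes "\<sigma> \<in> {[1, 1], [1, 2], [1, 2, 1]}"
  shows "is_class (sortable_ascent_sequences \<sigma>)"
proof -
  have "is_class (sortable_ascent_sequences [1, 1])"
    by (rule class_if_sortable_iff_avoids[OF sortable_11_iff])
  moreover have "is_class (sortable_ascent_sequences [1, 2])"
    by (rule class_if_sortable_iff_avoids[of _ "{[2, 1, 3]}"]) (use sortable_12_iff in blast)
  moreover have "is_class (sortable_ascent_sequences [1, 2, 1])"
    by (rule class_if_sortable_iff_avoids[of _ "{[1, 2, 1, 3]}"]) (use sortable_121_iff in blast)
  ultimately show ?thesis using assms by blast
qed

section \<open>Patterns containing 123\<close>

lemma stack_output_without_pops: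
  assumes "\<not> contains (rev \<pi>) \<sigma>"
  shows "stack_after \<sigma> [] \<pi> = rev \<pi> \<and> output_after \<sigma> [] \<pi> = []"
  using assms
proof (induction \<pi> rule: rev_induct)
  case (snoc a \<pi>)
  from snoc.prems have a: "\<not> contains (a # rev \<pi>) \<sigma>" by simp
  then have "\<not> contains (rev \<pi>) \<sigma>" using contains_mono[of "rev \<pi>" \<sigma> "a # rev \<pi>"] by auto
  with snoc.IH a show ?case by (simp add: stack_after_snoc output_after_append pop_for_none)
qed simp

lemma stack_output_eq_rev: "\<not> contains (rev \<pi>) \<sigma> \<Longrightarrow> stack_output \<sigma> \<pi> = rev \<pi>"
  using stack_run_append[of \<sigma> "[]" \<pi> "[]"] stack_output_without_pops
  by (simp add: stack_output_def)

lemma longest_prefix_without_pops: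
  assumes "contains (rev \<pi>) \<sigma>" and "2 \<le> length \<sigma>"
  shows "\<exists>\<alpha> k \<beta>. \<pi> = \<alpha> @ k # \<beta> \<and> \<not> contains (rev \<alpha>) \<sigma> \<and> contains (k # rev \<alpha>) \<sigma>"
  using assms(1)
proof (induction \<pi> rule: rev_induct)
  case Nil
  with empty_stack_avoids[OF assms(2)] show ?case by simp
next
  case (snoc a \<pi>)
  show ?case
  proof (cases "contains (rev \<pi>) \<sigma>")
    case True
    with snoc.IH obtain \<alpha> k \<beta> where "\<pi> = \<alpha> @ k # \<beta>" "\<not> contains (rev \<alpha>) \<sigma>" "contains (k # rev \<alpha>) \<sigma>"
      by blast
    then show ?thesis by (intro exI[of _ \<alpha>] exI[of _ k] exI[of _ "\<beta> @ [a]"]) simp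
  next
    case False
    with snoc.prems show ?thesis by (intro exI[of _ \<pi>] exI[of _ a] exI[of _ "[]"]) simp
  qed
qed

lemma contains_132_iff_inversion_in_rev:
  assumes x: "x \<in> ascent_sequences"
  shows "contains x [1, 3, 2] \<longleftrightarrow> (\<exists>y z. subseq [y, z] (rev x) \<and> 2 \<le> y \<and> y < z)"
proof
  assume "contains x [1, 3, 2]"
  then obtain a z y where ayz: "subseq [a, z, y] x" "a < y" "y < z" unfolding contains_132 by blast
  then have "1 \<le> a" using ascent_pos[OF x] set_subset_if_subseq[OF ayz(1)] by simp
  moreover have "subseq (rev [y, z]) (rev (rev x))" using subseq_Cons'[OF ayz(1)] by simp
  ultimately show "\<exists>y z. subseq [y, z] (rev x) \<and> 2 \<le> y \<and> y < z"
    using ayz unfolding subseq_rev_iff by (intro exI[of _ y] exI[of _ z]) simp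
next
  assume "\<exists>y z. subseq [y, z] (rev x) \<and> 2 \<le> y \<and> y < z"
  then obtain y z where yz: "subseq [y, z] (rev x)" "2 \<le> y" "y < z" by blast
  then have "subseq (rev [y, z]) (rev (rev x))" unfolding subseq_rev_iff by simp
  then have zy: "subseq [z, y] x" by simp
  obtain x' where x': "x = 1 # x'" using hd_ascent[OF x] by blast
  with zy yz have "subseq [1, z, y] x" using subseq_Cons_iff[of z "[y]" 1 x'] by auto
  with yz show "contains x [1, 3, 2]" unfolding contains_132
    by (intro exI[of _ 1] exI[of _ z] exI[of _ y]) simp
qed

text \<open>
  Only the letter playing the \<open>1\<close> of the pattern \<open>123\<close> can be the new
  letter \<open>k\<close>, hence the letters playing \<open>2\<close> and \<open>3\<close> are on
  the stack.
\<close>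

lemma pattern_123_above_push:
  assumes "contains \<sigma> [1, 2, 3]" and "contains (k # s) \<sigma>" and "\<forall>a\<in>set (k # s). 1 \<le> a"
  shows "\<exists>y z. subseq [y, z] s \<and> 2 \<le> y \<and> y < z"
proof -
  from contains_trans[OF assms(2,1)] obtain a y z
    where ayz: "subseq [a, y, z] (k # s)" "a < y" "y < z" unfolding contains_123 by blast
  have "1 \<le> a" using set_subset_if_subseq[OF ayz(1)] assms(3) by auto
  moreover from ayz(1) have "subseq [y, z] s" unfolding subseq_Cons_iff by (blast dest: subseq_Cons')
  ultimately show ?thesis using ayz by (intro exI[of _ y] exI[of _ z]) simp
qed

text \<open>
  If some push is in conflict with \<open>\<sigma>\<close>, the first such conflict shows an
  inversion on the stack; as the stack then holds the reversed input, the same inversion gives a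
  pattern \<open>132\<close>. So both sides fail.
\<close>

lemma sortable_iff_avoids_132:
  assumes \<sigma>: "\<sigma> \<in> ascent_sequences" "2 \<le> length \<sigma>" and "contains \<sigma> [1, 2, 3]"
    and x: "x \<in> ascent_sequences"
  shows "stack_sortable \<sigma> x \<longleftrightarrow> \<not> contains x [1, 3, 2]"
proof (cases "contains (rev x) \<sigma>")
  case False
  then show ?thesis
    unfolding stack_sortable_iff[OF \<sigma> x] contains_132_iff_inversion_in_rev[OF x] by (simp add: stack_output_eq_rev)
next
  case True
  from longest_prefix_without_pops[OF True \<sigma>(2)] obtain \<alpha> k \<beta> where split: "x = \<alpha> @ k # \<beta>"
    and \<alpha>: "\<not> contains (rev \<alpha>) \<sigma>" "contains (k # rev \<alpha>) \<sigma>" by blast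
  have "\<forall>a\<in>set (k # rev \<alpha>). 1 \<le> a" using ascent_pos[OF x] split by auto
  from pattern_123_above_push[OF assms(3) \<alpha>(2) this] obtain y z
    where yz: "subseq [y, z] (rev \<alpha>)" "2 \<le> y" "y < z" by blast
  have "subseq (rev \<alpha>) (stack_output \<sigma> x)"
    unfolding stack_output_def split stack_run_append
    using stack_output_without_pops[OF \<alpha>(1)] stack_before_output by simp
  with yz have "\<not> stack_sortable \<sigma> x"
    unfolding stack_sortable_iff[OF \<sigma> x] using subseq_order.trans by blast
  moreover have "subseq [y, z] (rev x)" using yz(1) by (auto simp: split)
  then have "contains x [1, 3, 2]" using yz contains_132_iff_inversion_in_rev[OF x] by blast
  ultimately show ?thesis by simp
qed

section \<open>Patterns over two letters\<close>
text \<open>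
  Before the first letter other than \<open>1\<close> there is no ascent, so this letter is
  \<open>2\<close>, and a letter above \<open>2\<close> completes \<open>123\<close>.
\<close>

lemma binary_if_avoids_123:
  assumes x: "x \<in> ascent_sequences" and "\<not> contains x [1, 2, 3]"
  shows "set x \<subseteq> {1, 2}"
proof (rule ccontr)
  assume "\<not> set x \<subseteq> {1, 2}"
  then obtain b where b: "b \<in> set x" "b \<noteq> 1" "b \<noteq> 2" by blast
  obtain \<alpha> a \<beta> where split: "x = \<alpha> @ a # \<beta>" and a: "a \<noteq> 1" "\<forall>c\<in>set \<alpha>. c = 1"
    using split_list_first_prop[of x "\<lambda>c. c \<noteq> 1"] b by auto
  obtain x' where "x = 1 # x'" using hd_ascent[OF x] by blast
  with split a obtain \<alpha>' where \<alpha>: "\<alpha> = 1 # \<alpha>'" by (cases \<alpha>) auto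
  have "{j. Suc j < length \<alpha> \<and> \<alpha> ! j < \<alpha> ! Suc j} = {}"
  proof -
    have "\<alpha> ! j = 1" if "j < length \<alpha>" for j using a(2) that by simp
    then show ?thesis by (auto dest: Suc_lessD)
  qed
  then have "asc \<alpha> = 0" unfolding asc_def by (simp only: card.empty)
  have "x ! length \<alpha> \<le> 2 + asc (take (length \<alpha>) x)"
  proof -
    have "1 \<le> length \<alpha> \<and> length \<alpha> < length x" using split \<alpha> by simp
    with x show ?thesis unfolding ascent_sequences_def by blast
  qed
  then have "a \<le> 2" using \<open>asc \<alpha> = 0\<close> split by simp
  moreover have "1 \<le> a" "1 \<le> b" using ascent_pos[OF x] split b by auto
  ultimately have "a = 2" "2 < b" using a(1) b by auto
  moreover from this have "b \<in> set \<beta>" using b(1) split a(2) by auto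
  ultimately have "subseq [1, 2, b] x" by (simp add: split \<alpha> subseq_singleton_left subseq_drop_many)
  with \<open>2 < b\<close> have "contains x [1, 2, 3]"
    unfolding contains_123 by (intro exI[of _ 1] exI[of _ 2] exI[of _ b]) simp
  with assms(2) show False ..
qed

lemma letters_le_hd_if_no_ascent:
  "asc x = 0 \<Longrightarrow> a \<in> set x \<Longrightarrow> a \<le> hd x"
proof (induction x arbitrary: a rule: rev_induct)
  case (snoc b x)
  show ?case
  proof (cases "x = []")
    case False
    with snoc.prems(1) have "asc x = 0" "b \<le> last x" by (auto simp: asc_snoc split: if_splits)
    with snoc.IH[of "last x"] snoc.IH[of a] snoc.prems(2) False show ?thesis by auto
  qed (use snoc.prems in simp)
qed simp

lemma pop_for_exactly:
  assumes "contains (k # d # v) \<sigma>" and "\<not> contains (k # v) \<sigma>"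
  shows "pop_for \<sigma> k (w @ d # v) = (w @ [d], v)"
proof (induction w)
  case Nil
  then show ?case using assms by (simp add: pop_for_none)
next
  case (Cons t w)
  have "subseq (k # d # v) (k # t # w @ d # v)"
    using subseq_drop_many[of "d # v" "d # v" "t # w"] by simp
  with assms(1) have "contains (k # (t # w) @ d # v) \<sigma>" using contains_mono by auto
  with Cons show ?case by simp
qed

text \<open>
  \<open>2321\<close> is the stack content reached from the input \<open>1232\<close>. The
  occurrence of \<open>\<sigma>\<close> starts with its least letter and has at most two
  different letters, which leaves \<open>22\<close>, \<open>23\<close> and \<open>232\<close>.
\<close>

lemma contains_2321:
  assumes \<sigma>: "\<sigma> \<in> ascent_sequences" "2 \<le> length \<sigma>" "set \<sigma> \<subseteq> {1, 2}"
    and "contains [2, 3, 2, 1] \<sigma>"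
  shows "\<sigma> \<in> {[1, 1], [1, 2], [1, 2, 1]}"
proof -
  from assms(4) obtain z where z: "subseq z [2, 3, 2, 1]" "order_iso z \<sigma>" unfolding contains_iff by blast
  from hd_ascent[OF \<sigma>(1)] obtain \<tau> where \<tau>: "\<sigma> = 1 # \<tau>" by blast
  from z(1) have "z \<in> set (subseqs [2, 3, 2, 1])" unfolding in_set_subseqs .
  then show ?thesis using z(2) \<sigma>(2,3) unfolding \<tau>
    by (simp only: subseqs.simps Let_def list.map append.simps list.set)
      (auto simp: list_all2_Cons1)
qed

text \<open>
  The input is the reversal of the stack content \<open>w d v\<close>, followed by \<open>3 1
  2\<close>. It contains \<open>1232\<close>, which is not sortable. The last three letters act
  as follows: \<open>3\<close> is pushed onto \<open>w d v\<close>; the next \<open>1\<close>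
  pops everything down to and including \<open>d\<close>; then \<open>2\<close> is pushed without
  pops. The output is \<open>3 w d 2 1 v\<close>, and with \<open>3\<close> in front of letters
  at most \<open>2\<close> it has no inversion.
\<close>

lemma not_class_if_stack_content:
  assumes \<sigma>: "\<sigma> \<in> ascent_sequences" "2 \<le> length \<sigma>" "set \<sigma> \<subseteq> {1, 2}"
      "\<sigma> \<notin> {[1, 1], [1, 2], [1, 2, 1]}"
    and Q: "set (w @ d # v) \<subseteq> {1, 2}" "2 \<in> set (w @ d # v)" "last (d # v) = 1"
    and fits: "\<not> contains (3 # w @ d # v) \<sigma>"
    and pops: "contains (1 # d # v) \<sigma>"
    and stops: "\<not> contains (2 # 1 # v) \<sigma>"
  shows "\<not> is_class (sortable_ascent_sequences \<sigma>)"
proof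
  let ?Q = "w @ d # v" and ?x = "rev (w @ d # v) @ [3, 1, 2]"
  assume cls: "is_class (sortable_ascent_sequences \<sigma>)"
  have hd: "rev ?Q \<noteq> [] \<and> hd (rev ?Q) = 1"
    unfolding hd_rev using Q(3) by simp
  have "asc (rev ?Q) \<noteq> 0"
    using letters_le_hd_if_no_ascent[of "rev ?Q" 2] hd Q(2) by (auto simp del: rev_append)
  have xA: "?x \<in> ascent_sequences"
    unfolding ascent_sequences_def
  proof (intro CollectI conjI ballI allI impI)
    show "?x ! 0 = 1" using hd by (metis hd_append2 hd_conv_nth append_is_Nil_conv)
    fix a assume "a \<in> set ?x"
    then show "1 \<le> a" using Q(1) by auto
  next
    fix i assume i: "1 \<le> i \<and> i < length ?x"
    show "?x ! i \<le> 2 + asc (take i ?x)"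
    proof (cases "i = length ?Q")
      case True
      then have "?x ! i = 3" "take i ?x = rev ?Q" by (simp_all add: nth_append)
      with \<open>asc (rev ?Q) \<noteq> 0\<close> show ?thesis by simp
    next
      case False
      have "?x ! i \<in> {1, 2}"
      proof (cases "i < length ?Q")
        case True
        then have "?x ! i \<in> set (rev ?Q)"
          by (metis length_rev nth_append nth_mem)
        with Q(1) show ?thesis by auto
      next
        case f: False
        with False i have "i = Suc (length (rev ?Q)) \<or> i = Suc (Suc (length (rev ?Q)))"
          by (simp only: length_append length_rev list.size) linarith
        then show ?thesis by (auto simp: nth_append simp del: rev_append)
      qed
      then show ?thesis by auto
    qed
  qed simp
  have "\<not> contains (1 # v) \<sigma>" using stops contains_mono[of "1 # v" \<sigma> "2 # 1 # v"] by blast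
  from pop_for_exactly[OF pops this, of "3 # w"]
  have pop1: "pop_for \<sigma> 1 (3 # ?Q) = (3 # w @ [d], v)" by simp
  have "?x = rev (3 # ?Q) @ [1, 2]" by simp
  moreover have "stack_output \<sigma> (rev (3 # ?Q) @ [1, 2]) = stack_run \<sigma> (3 # ?Q) [1, 2]"
    unfolding stack_output_def stack_run_append
    using stack_output_without_pops[of "rev (3 # ?Q)" \<sigma>] fits by simp
  moreover have "\<dots> = 3 # (w @ [d] @ 2 # 1 # v)"
    unfolding stack_run_Cons pop1 using pop_for_none[OF stops] by simp
  ultimately have out: "stack_output \<sigma> ?x = 3 # (w @ [d] @ 2 # 1 # v)" by metis
  have "stack_sortable \<sigma> ?x"
    unfolding stack_sortable_iff[OF \<sigma>(1,2) xA] out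
  proof (intro notI, elim exE conjE)
    fix y z :: nat
    assume yz: "subseq [y, z] (3 # (w @ [d] @ 2 # 1 # v))" "2 \<le> y" "y < z"
    have small: "a \<le> 2" if "a \<in> set (w @ [d] @ 2 # 1 # v)" for a using that Q(1) by auto
    from yz(1) have "z \<in> set (w @ [d] @ 2 # 1 # v)"
      unfolding subseq_pair_Cons_iff[of y z 3] using set_subset_if_subseq[of "[y, z]" "w @ [d] @ 2 # 1 # v"]
      by auto
    from small[OF this] yz show False by simp
  qed
  with xA have "?x \<in> sortable_ascent_sequences \<sigma>" by (simp add: sortable_ascent_sequences_def)
  moreover have "[1, 2, 3, 2] \<in> ascent_sequences"
  proof -
    have "asc [1] = 0" by (simp add: asc_def)
    then have "asc [1, 2] = 1" using asc_snoc[of "[1]" 2] by simp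
    then have "asc [1, 2, 3] = 2" using asc_snoc[of "[1, 2]" 3] by simp
    with \<open>asc [1, 2] = 1\<close> show ?thesis
      by (auto simp: ascent_sequences_def less_Suc_eq numeral_eq_Suc)
  qed
  moreover have "contains ?x [1, 2, 3, 2]"
  proof -
    obtain q where q: "rev ?Q = 1 # q" using hd by (metis list.collapse)
    have "2 \<in> set (rev ?Q)" using Q(2) unfolding set_rev .
    then have "subseq [1, 2] (rev ?Q)" unfolding q by (auto simp: subseq_singleton_left)
    then have "subseq ([1, 2] @ [3, 2]) ?x"
      by (rule list_emb_append_mono) simp
    then show ?thesis using contains_mono[OF contains_self] by auto
  qed
  ultimately have "[1, 2, 3, 2] \<in> sortable_ascent_sequences \<sigma>"
    using cls unfolding is_class_def by blast
  then have "stack_sortable \<sigma> [1, 2, 3, 2]" and A: "[1, 2, 3, 2] \<in> ascent_sequences"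
    unfolding sortable_ascent_sequences_def by blast+
  moreover have "stack_output \<sigma> [1, 2, 3, 2] = [2, 3, 2, 1]"
    using stack_output_eq_rev[of "[1, 2, 3, 2]" \<sigma>] contains_2321[OF \<sigma>(1-3)] \<sigma>(4) by auto
  moreover have "subseq [2, 3] [2, 3, 2, 1::nat]" by simp
  ultimately show False unfolding stack_sortable_iff[OF \<sigma>(1,2) A] by force
qed

lemma constant_if_shift: "c # l = l @ [a] \<Longrightarrow> set (c # l) \<subseteq> {a}"
proof (induction l arbitrary: c)
  case (Cons b l)
  then have "c = b" and shift: "b # l = l @ [a]" by simp_all
  from Cons.IH[OF shift] \<open>c = b\<close> show ?case by simp
qed simp

lemma binary_order_iso_eq:
  assumes "order_iso z \<sigma>" and "set z \<subseteq> {1, 2}" and "set \<sigma> = {1, 2}"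
  shows "z = \<sigma>"
proof -
  have len: "length z = length \<sigma>" using assms(1) by (simp add: order_iso_def)
  from assms(3) have "1 \<in> set \<sigma>" "2 \<in> set \<sigma>" by auto
  then obtain i j where ij: "i < length \<sigma>" "\<sigma> ! i = 1" "j < length \<sigma>" "\<sigma> ! j = 2"
    unfolding in_set_conv_nth by blast
  have zs: "z ! s = 1 \<or> z ! s = 2" if "s < length \<sigma>" for s
    using subsetD[OF assms(2) nth_mem[of s z]] that len by auto
  have \<sigma>s: "\<sigma> ! s = 1 \<or> \<sigma> ! s = 2" if "s < length \<sigma>" for s
    using that assms(3) nth_mem[of s \<sigma>] by auto
  have iso: "(z ! s < z ! t \<longleftrightarrow> \<sigma> ! s < \<sigma> ! t) \<and> (z ! s = z ! t \<longleftrightarrow> \<sigma> ! s = \<sigma> ! t)"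
    if "s < length \<sigma>" "t < length \<sigma>" for s t
    using assms(1) that unfolding order_iso_def by blast
  have "z ! i < z ! j" using iso[of i j] ij by simp
  with zs[of i] zs[of j] ij have "z ! i = 1" "z ! j = 2" by auto
  show ?thesis
  proof (rule nth_equalityI[OF len])
    fix s assume "s < length z"
    then have "s < length \<sigma>" using len by simp
    with \<sigma>s[of s] show "z ! s = \<sigma> ! s"
      using iso[of s i] iso[of s j] ij \<open>z ! i = 1\<close> \<open>z ! j = 2\<close> by auto
  qed
qed

text \<open>
  The first letter of \<open>\<sigma>\<close> lies strictly below another one, so \<open>h \<ge>
  2\<close> is too large to play it next to letters from \<open>{1, 2}\<close>. On two letters
  order isomorphism is equality.
\<close>

lemma subseq_if_contains_below_large:
  assumes \<sigma>: "\<sigma> = 1 # \<tau>" "set \<sigma> = {1, 2}" and c: "contains (h # l) \<sigma>"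
    and l: "set l \<subseteq> {1, 2}" "2 \<le> h"
  shows "subseq \<sigma> l"
proof -
  from c obtain z where z: "subseq z (h # l)" "order_iso z \<sigma>" unfolding contains_iff by blast
  from z(2) \<sigma>(1) obtain a z' where za: "z = a # z'" by (cases z) auto
  from \<sigma>(2) have "2 \<in> set \<sigma>" by simp
  with \<sigma>(1) have "2 \<in> set \<tau>" by simp
  then obtain i where "i < length \<tau>" "\<tau> ! i = 2" unfolding in_set_conv_nth by blast
  with z(2) have "a < z' ! i" "z' ! i \<in> set z'" unfolding za \<sigma>(1)
    by (auto simp: list_all2_conv_all_nth)
  have "subseq z l"
  proof (rule ccontr)
    assume "\<not> subseq z l"
    with z(1) have "a = h" "subseq z' l" unfolding za subseq_Cons_iff by blast+
    then have "z' ! i \<in> {1, 2}" using l(1) set_subset_if_subseq \<open>z' ! i \<in> set z'\<close> by blast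
    with \<open>a < z' ! i\<close> \<open>a = h\<close> l(2) show False by auto
  qed
  moreover have "z = \<sigma>"
    using binary_order_iso_eq[OF z(2) _ \<sigma>(2)] set_subset_if_subseq[OF \<open>subseq z l\<close>] l(1) by blast
  ultimately show ?thesis by simp
qed

lemma multiplicity_if_contains_constant:
  assumes "contains h (replicate n 1)"
  shows "\<exists>a. n \<le> length (filter ((=) a) h)"
proof -
  from assms obtain z where z: "subseq z h" "order_iso z (replicate n 1)" unfolding contains_iff by blast
  from z(2) have len: "length z = n" by (simp add: order_iso_def)
  have const: "z ! s = z ! 0" if "s < n" for s
  proof -
    from that have "0 < n" by simp
    with that z(2) have "z ! s = z ! 0 \<longleftrightarrow> replicate n (1::nat) ! s = replicate n 1 ! 0"
      unfolding order_iso_def length_replicate by blast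
    with that \<open>0 < n\<close> show ?thesis by simp
  qed
  have "\<forall>a\<in>set z. z ! 0 = a"
  proof
    fix a assume "a \<in> set z"
    then obtain s where "s < length z" "z ! s = a" unfolding in_set_conv_nth by blast
    with const[of s] len show "z ! 0 = a" by simp
  qed
  then have "filter ((=) (z ! 0)) z = z" by (rule filter_True)
  moreover have "subseq (filter ((=) (z ! 0)) z) (filter ((=) (z ! 0)) h)"
    using z(1) by (rule subseq_filter)
  ultimately have "n \<le> length (filter ((=) (z ! 0)) h)"
    using len list_emb_length[of "(=)" z "filter ((=) (z ! 0)) h"] by simp
  then show ?thesis ..
qed

text \<open>
  If \<open>\<sigma> = 1 c \<tau>\<close> has a letter \<open>2\<close>, the stack content
  \<open>c \<tau> 1\<close> has the length of \<open>\<sigma>\<close>. It would have to coincide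
  with \<open>\<sigma>\<close> in order to contain it, and an equation \<open>a u = u 1\<close>,
  here with \<open>a = 1\<close> and \<open>u = c \<tau>\<close>, holds only for words of ones
  (\<open>constant_if_shift\<close>). For \<open>1 \<tau> 1\<close>, the content after the pops,
  the equation is \<open>c \<tau> = \<tau> 1\<close>. A pattern of ones only, of length at least
  \<open>3\<close>, is handled by counting.
\<close>

lemma not_class_if_binary:
  assumes \<sigma>: "\<sigma> \<in> ascent_sequences" "2 \<le> length \<sigma>" "set \<sigma> \<subseteq> {1, 2}"
      "\<sigma> \<notin> {[1, 1], [1, 2], [1, 2, 1]}"
  shows "\<not> is_class (sortable_ascent_sequences \<sigma>)"
proof (cases "2 \<in> set \<sigma>")
  case True
  obtain c \<tau> where \<tau>: "\<sigma> = 1 # c # \<tau>" using hd_ascent[OF \<sigma>(1)] \<sigma>(2)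
    by (metis One_nat_def Suc_1 Suc_le_length_iff list.inject)
  have set\<sigma>: "set \<sigma> = {1, 2}" using True \<sigma>(3) \<tau> by auto
  have c\<tau>: "set (c # \<tau> @ [1]) \<subseteq> {1, 2}" using \<sigma>(3) \<tau> by auto
  have two: "2 \<in> set (c # \<tau>)" using True \<tau> by auto
  have same: "\<sigma> = l" if "subseq \<sigma> l" "length l = length \<sigma>" for l
    using that by (metis subseq_same_length)
  show ?thesis
  proof (rule not_class_if_stack_content[OF \<sigma>, of "[]" c "\<tau> @ [1]"])
    show "set ([] @ c # \<tau> @ [1]) \<subseteq> {1, 2}" using c\<tau> by simp
    show "2 \<in> set ([] @ c # \<tau> @ [1])" using two by auto
    show "last (c # \<tau> @ [1]) = 1" by simp
    show "contains (1 # c # \<tau> @ [1]) \<sigma>"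
      using contains_mono[OF contains_self, of \<sigma> "\<sigma> @ [1]"] by (simp add: \<tau> prefix_imp_subseq)
    show "\<not> contains (3 # [] @ c # \<tau> @ [1]) \<sigma>"
    proof
      assume "contains (3 # [] @ c # \<tau> @ [1]) \<sigma>"
      then have "subseq \<sigma> (c # \<tau> @ [1])"
        using subseq_if_contains_below_large[OF \<tau> set\<sigma> _ c\<tau>, of 3] by simp
      from same[OF this] have "1 # c # \<tau> = (c # \<tau>) @ [1]" by (simp add: \<tau>)
      from constant_if_shift[OF this] two show False by auto
    qed
    show "\<not> contains (2 # 1 # \<tau> @ [1]) \<sigma>"
    proof
      assume "contains (2 # 1 # \<tau> @ [1]) \<sigma>"
      then have "subseq \<sigma> (1 # \<tau> @ [1])"
        using subseq_if_contains_below_large[OF \<tau> set\<sigma>, of 2 "1 # \<tau> @ [1]"] c\<tau> by auto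
      from same[OF this] have "c # \<tau> = \<tau> @ [1]" by (simp add: \<tau>)
      from constant_if_shift[OF this] two show False by auto
    qed
  qed
next
  case False
  with \<sigma>(3) have "\<forall>a\<in>set \<sigma>. a = 1" by auto
  then have rep: "\<sigma> = replicate (length \<sigma>) 1" by (simp add: replicate_length_same)
  have "length \<sigma> \<noteq> 2"
  proof
    assume "length \<sigma> = 2"
    with rep \<sigma>(4) show False by (simp add: numeral_2_eq_2)
  qed
  with \<sigma>(2) have "\<exists>k. length \<sigma> = Suc (Suc (Suc k))" by presburger
  then obtain k where k: "length \<sigma> = Suc (Suc (Suc k))" ..
  let ?v = "replicate (Suc k) (1::nat)"
  have few: "\<not> contains h \<sigma>" if "\<And>a. length (filter ((=) a) h) \<le> Suc (Suc k)" for h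
  proof
    assume "contains h \<sigma>"
    then obtain a where "length \<sigma> \<le> length (filter ((=) a) h)"
      using rep multiplicity_if_contains_constant by metis
    with that[of a] k show False by simp
  qed
  show ?thesis
  proof (rule not_class_if_stack_content[OF \<sigma>, of "[2]" 1 ?v])
    have "\<sigma> = 1 # 1 # ?v" using rep k by simp
    then show "contains (1 # 1 # ?v) \<sigma>" using contains_self by metis
    show "\<not> contains (3 # [2] @ 1 # ?v) \<sigma>"
      by (rule few) (auto simp: filter_replicate)
    show "\<not> contains (2 # 1 # ?v) \<sigma>"
      by (rule few) (auto simp: filter_replicate)
  qed auto
qed

theorem corollary8p22:
  fixes \<sigma> :: "nat list"
  assumes "\<sigma> \<in> ascent_sequences" and "2 \<le> length \<sigma>"
  shows "(\<sigma> \<in> {[1, 1], [1, 2], [1, 2, 1]} \<longrightarrow> is_class (sortable_ascent_sequences \<sigma>)) \<and>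
    (\<sigma> \<notin> {[1, 1], [1, 2], [1, 2, 1]} \<longrightarrow>
      (is_class (sortable_ascent_sequences \<sigma>) \<longleftrightarrow> contains \<sigma> [1, 2, 3])) \<and>
    (contains \<sigma> [1, 2, 3] \<longrightarrow>
      sortable_ascent_sequences \<sigma> = avoiding_ascent_sequences [1, 3, 2])"
proof (intro conjI impI)
  assume "\<sigma> \<in> {[1, 1], [1, 2], [1, 2, 1]}"
  then show "is_class (sortable_ascent_sequences \<sigma>)" by (rule is_class_11_12_121)
next
  assume other: "\<sigma> \<notin> {[1, 1], [1, 2], [1, 2, 1]}"
  show "is_class (sortable_ascent_sequences \<sigma>) \<longleftrightarrow> contains \<sigma> [1, 2, 3]"
  proof
    assume "contains \<sigma> [1, 2, 3]"
    then show "is_class (sortable_ascent_sequences \<sigma>)"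
      by (intro class_if_sortable_iff_avoids[of _ "{[1, 3, 2]}"])
        (use sortable_iff_avoids_132[OF assms] in blast)
  next
    assume cls: "is_class (sortable_ascent_sequences \<sigma>)"
    show "contains \<sigma> [1, 2, 3]"
    proof (rule ccontr)
      assume "\<not> contains \<sigma> [1, 2, 3]"
      from not_class_if_binary[OF assms binary_if_avoids_123[OF assms(1) this] other] cls
      show False ..
    qed
  qed
next
  assume "contains \<sigma> [1, 2, 3]"
  then show "sortable_ascent_sequences \<sigma> = avoiding_ascent_sequences [1, 3, 2]"
    using sortable_iff_avoids_132[OF assms]
    unfolding sortable_ascent_sequences_def avoiding_ascent_sequences_def by blast
qed

end
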